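(* Let $H$ be a compact subgroup of a locally compact group $G$. Then the group $G$ has property (RD) if and only if the Hecke pair $(G,H)$ has property (RD).
   Context: $G$ carries a right Haar measure $\mu$, $H$ a Haar measure; since $H$ is compact, $\Delta_G|_H=\Delta_H=1$ and there is a right $G$-invariant measure $\nu$ on $H\backslash G$ satisfying Weil's formula. $\mathcal H(G,H)$ is the space of compactly supported continuous functions $f$ on $H\backslash G$ which are right $H$-invariant ($f(Hxh)=f(Hx)$), with product $f*g(Hx)=\int_{H\backslash G}f(Hxy^{-1})g(Hy)\,d\nu(Hy)$; the left regular representation $\lambda(f)\xi=f*\xi$ acts by bounded operators on $L^2(H\backslash G,\nu)$ (for compact $H$, $(G,H)$ is a Hecke pair). For $H=\{e\}$ this is $C_c(G)$ with convolution $f*g(x)=\int_Gf(xy^{-1})g(y)\,d\mu(y)$ acting on $L^2(G)$. A length function on $(G,H)$ is a Borel function $l:G\to[0,\infty)$ with $l(e)=0$, $l(g)=l(g^{-1})$, $l(gh)\le l(g)+l(h)$ and $l|_H=0$ (a length function on $G$ when $H=\{e\}$); it is locally bounded if the induced function on $H\backslash G$ is bounded on compact subsets. $(G,H)$ has property (RD) if there exist a locally bounded length function $l$ on $(G,H)$ and $s,c>0$ with $\|\lambda(f)\|\le c\big(\int_{H\backslash G}|f(Hx)|^2(1+l(x))^{2s}d\nu(Hx)\big)^{1/2}$ for all $f\in\mathcal H(G,H)$; the group $G$ has property (RD) if $(G,\{e\})$ does. *)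

theory Defs
  imports "HOL-Analysis.Analysis"
begin

text \<open>Conventions. The locally compact group G is a type 'g of class topological_group_add
  (a possibly NON-commutative topological group, written additively: x + y is the product xy,
  - x the inverse, 0 the unit), Hausdorff (t2_space) and locally compact.\<close>

definition locally_compact_group :: "'g::{topological_group_add,t2_space} itself \<Rightarrow> bool" where
  "locally_compact_group _ \<longleftrightarrow> locally_compact_space (euclidean :: 'g topology)"

definition right_haar_measure :: "'g::{topological_group_add,t2_space} measure \<Rightarrow> bool" where
  "right_haar_measure \<mu> \<longleftrightarrow>
     sets \<mu> = sets borel \<and>
     (\<forall>E\<in>sets borel. \<forall>g. emeasure \<mu> ((\<lambda>x. x + g) ` E) = emeasure \<mu> E) \<and>
     (\<forall>K. compact K \<longrightarrow> emeasure \<mu> K < \<infinity>) \<and>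
     (\<forall>U. open U \<and> U \<noteq> {} \<longrightarrow> emeasure \<mu> U > 0) \<and>
     (\<forall>E\<in>sets borel. emeasure \<mu> E = (INF U\<in>{U. open U \<and> E \<subseteq> U}. emeasure \<mu> U)) \<and>
     (\<forall>U. open U \<longrightarrow> emeasure \<mu> U = (SUP K\<in>{K. compact K \<and> K \<subseteq> U}. emeasure \<mu> K))"

definition compact_subgroup :: "'g::{topological_group_add,t2_space} set \<Rightarrow> bool" where
  "compact_subgroup H \<longleftrightarrow> 0 \<in> H \<and> (\<forall>x\<in>H. \<forall>y\<in>H. x + y \<in> H) \<and> (\<forall>x\<in>H. - x \<in> H) \<and> compact H"

definition rcoset :: "'g::group_add set \<Rightarrow> 'g \<Rightarrow> 'g set" where
  "rcoset H x = (\<lambda>h. h + x) ` H"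

definition cosets :: "'g::group_add set \<Rightarrow> 'g set set" where
  "cosets H = range (rcoset H)"

definition rep :: "'g set \<Rightarrow> 'g" where
  "rep C = (SOME x. x \<in> C)"

definition coset_topology :: "'g::{topological_group_add,t2_space} set \<Rightarrow> 'g set topology" where
  "coset_topology H = topology (\<lambda>U. U \<subseteq> cosets H \<and> open (rcoset H -` U))"

definition coset_borel :: "'g::{topological_group_add,t2_space} set \<Rightarrow> 'g set measure" where
  "coset_borel H = sigma (cosets H) {U. openin (coset_topology H) U}"

text \<open>The right G-invariant measure nu on H\G: image of the Haar measure under the
  projection G -> H\G (for compact H this satisfies Weil's formula, up to the
  normalisation of the Haar measure of H).\<close>
definition coset_measure :: "'g::{topological_group_add,t2_space} measure \<Rightarrow> 'g set \<Rightarrow> 'g set measure" where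
  "coset_measure \<mu> H = distr \<mu> (coset_borel H) (rcoset H)"

definition hecke_space :: "'g::{topological_group_add,t2_space} set \<Rightarrow> ('g set \<Rightarrow> complex) set" where
  "hecke_space H = {f.
     continuous_map (coset_topology H) euclidean f \<and>
     compactin (coset_topology H) ((coset_topology H) closure_of {C \<in> cosets H. f C \<noteq> 0}) \<and>
     (\<forall>x. \<forall>h\<in>H. f (rcoset H (x + h)) = f (rcoset H x))}"

definition hecke_conv :: "'g::{topological_group_add,t2_space} measure \<Rightarrow> 'g set \<Rightarrow>
    ('g set \<Rightarrow> complex) \<Rightarrow> ('g set \<Rightarrow> complex) \<Rightarrow> 'g set \<Rightarrow> complex" where
  "hecke_conv \<mu> H f g C =
     (\<integral>D. f (rcoset H (rep C + - rep D)) * g D \<partial>coset_measure \<mu> H)"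

definition L2sq :: "'b measure \<Rightarrow> ('b \<Rightarrow> complex) \<Rightarrow> ennreal" where
  "L2sq M \<xi> = (\<integral>\<^sup>+ x. ennreal ((cmod (\<xi> x))\<^sup>2) \<partial>M)"

definition L2_space :: "'b measure \<Rightarrow> ('b \<Rightarrow> complex) set" where
  "L2_space M = {\<xi>. \<xi> \<in> borel_measurable M \<and> L2sq M \<xi> < \<infinity>}"

definition length_function :: "'g::{topological_group_add,t2_space} set \<Rightarrow> ('g \<Rightarrow> real) \<Rightarrow> bool" where
  "length_function H l \<longleftrightarrow>
     l \<in> borel_measurable borel \<and> (\<forall>g. l g \<ge> 0) \<and> l 0 = 0 \<and>
     (\<forall>g. l (- g) = l g) \<and> (\<forall>g h. l (g + h) \<le> l g + l h) \<and> (\<forall>h\<in>H. l h = 0)"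

definition locally_bounded_length :: "'g::{topological_group_add,t2_space} set \<Rightarrow> ('g \<Rightarrow> real) \<Rightarrow> bool" where
  "locally_bounded_length H l \<longleftrightarrow>
     (\<forall>K. compactin (coset_topology H) K \<longrightarrow> (\<exists>B. \<forall>x. rcoset H x \<in> K \<longrightarrow> l x \<le> B))"

text \<open>Property (RD) for the pair (G,H):
  ||lambda(f)|| \<le> c (int |f|^2 (1+l)^{2s} d nu)^{1/2}, the operator norm bound written out
  (in squared form) as a bound for all xi in L2(H\G,nu).\<close>
definition RD_pair :: "'g::{topological_group_add,t2_space} measure \<Rightarrow> 'g set \<Rightarrow> bool" where
  "RD_pair \<mu> H \<longleftrightarrow>
     (\<exists>l s c. length_function H l \<and> locally_bounded_length H l \<and> s > 0 \<and> c > 0 \<and>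
        (\<forall>f\<in>hecke_space H. \<forall>\<xi>\<in>L2_space (coset_measure \<mu> H).
           L2sq (coset_measure \<mu> H) (hecke_conv \<mu> H f \<xi>)
             \<le> ennreal (c\<^sup>2) *
               (\<integral>\<^sup>+ C. ennreal ((cmod (f C))\<^sup>2 * (1 + l (rep C)) powr (2 * s)) \<partial>coset_measure \<mu> H) *
               L2sq (coset_measure \<mu> H) \<xi>))"

definition RD_group :: "'g::{topological_group_add,t2_space} measure \<Rightarrow> bool" where
  "RD_group \<mu> \<longleftrightarrow> RD_pair \<mu> {0}"

end

theory Submission
  imports Defs
begin

text \<open>
  From \<open>G\<close> to \<open>(G,H)\<close>: functions on \<open>H\G\<close> pull back to \<open>G\<close>, compatibly with convolution and norms;
  only the length function has to be replaced by one that vanishes on \<open>H\<close> and dominates the given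
  one up to constants.

  From \<open>(G,H)\<close> to \<open>G\<close>: for nonnegative compactly supported continuous \<open>f\<close> and \<open>\<xi>\<close>, one wants the
  averages \<open>f\<^sup>#(z) = (\<integral>\<integral> f(uzv\<^sup>-\<^sup>1)\<^sup>2 du dv)\<^sup>1\<^sup>/\<^sup>2\<close> and \<open>\<xi>\<^sup>#(y) = (\<integral> \<xi>(vy)\<^sup>2 dv)\<^sup>1\<^sup>/\<^sup>2\<close>, for which
  Minkowski and Cauchy-Schwarz give \<open>\<parallel>f * \<xi>\<parallel> \<le> \<parallel>f\<^sup># * \<xi>\<^sup>#\<parallel>\<close>. Instead of Haar measure on \<open>H\<close>, the averages
  are taken over \<open>G\<close> against \<open>\<psi>(u) du\<close> with a bump function \<open>\<psi>\<close> that is right \<open>H\<close>-invariant. Right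
  invariance of \<open>\<mu>\<close> makes \<open>f\<^sup>#\<close> and \<open>\<xi>\<^sup>#\<close> \<open>H\<close>-invariant and gives
  \<open>\<integral>\<integral> \<psi>(v) F(vy) dv dy = (\<integral> \<psi>(y\<^sup>-\<^sup>1) dy) (\<integral> F)\<close>, so all norms change only by constants, and property
  (RD) tolerates constants. General \<open>\<xi>\<close> in \<open>L\<^sup>2\<close> follow by density and Fatou's lemma.
\<close>

section \<open>Compactly supported continuous functions\<close>

text \<open>The data contain no measure on \<open>H\<close>: the measure on the coset space is only
  the image of \<mu>. Smoothing by a function on \<open>G\<close> avoids constructing one. In (f *
  \<xi>)(ux), the integral over \<open>G\<close> of f(uxt^-1) \<xi>(t), writing t = vy puts the same
  \<open>v\<close> to the right of the argument of \<open>f\<close> and to the left of that of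
  \<xi>. So the average of \<open>f\<close> is two-sided, as membership in the Hecke space requires,
  while \<xi> is averaged on the left only, which is enough to descend to the coset space. The main
  obstacle is that \<open>G\<close> need be neither second countable nor sigma-compact. Then \<mu>
  may fail to be sigma-finite, and Tonelli's theorem cannot be quoted for arbitrary functions.
  Integrals are exchanged only for continuous compactly supported functions of two variables. This
  forces the weight to be continuous as well, hence a continuous majorant of the length function,
  and it is why general L2 functions enter only through approximation. \<open>G\<close> need not be
  unimodular either, so two constants occur, the integrals of \<psi>(y) and of \<psi>(y^-1).\<close>

definition Cc :: "('a::topological_space \<Rightarrow> real) \<Rightarrow> bool" where
  "Cc f \<longleftrightarrow> continuous_on UNIV f \<and> (\<exists>K. compact K \<and> (\<forall>x. f x \<noteq> 0 \<longrightarrow> x \<in> K))"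

lemma CcI: "continuous_on UNIV f \<Longrightarrow> compact K \<Longrightarrow> (\<And>x. f x \<noteq> 0 \<Longrightarrow> x \<in> K) \<Longrightarrow> Cc f"
  unfolding Cc_def by blast

lemma Cc_continuous: "Cc f \<Longrightarrow> continuous_on UNIV f"
  unfolding Cc_def by blast

lemma Cc_continuous_compose:
  "Cc f \<Longrightarrow> continuous_on S g \<Longrightarrow> continuous_on S (\<lambda>x. f (g x))"
  using continuous_on_compose2[OF Cc_continuous] by blast

lemma Cc_supportE:
  assumes "Cc f" obtains K where "compact K" "\<And>x. f x \<noteq> 0 \<Longrightarrow> x \<in> K"
  using assms unfolding Cc_def by blast

lemma Cc_borel: "Cc f \<Longrightarrow> f \<in> borel_measurable borel"
  by (simp add: Cc_def borel_measurable_continuous_onI)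

lemma Cc_bounded:
  assumes "Cc f" obtains B where "B \<ge> 0" "\<And>x. \<bar>f x\<bar> \<le> B"
proof -
  obtain K where K: "compact K" "\<And>x. f x \<noteq> 0 \<Longrightarrow> x \<in> K"
    using Cc_supportE[OF assms] by blast
  have "compact (f ` K)"
    using K(1) assms Cc_continuous compact_continuous_image continuous_on_subset by blast
  then obtain B where "\<forall>y\<in>f ` K. \<bar>y\<bar> \<le> B"
    using compact_imp_bounded bounded_real by blast
  then have "\<bar>f x\<bar> \<le> max 0 B" for x
    using K(2)[of x] by (cases "f x = 0") auto
  then show thesis using that[of "max 0 B"] by auto
qed

lemma Cc_mult_left:
  assumes "Cc f" "continuous_on UNIV g" shows "Cc (\<lambda>x. f x * g x)"
proof -
  obtain K where "compact K" "\<And>x. f x \<noteq> 0 \<Longrightarrow> x \<in> K" using Cc_supportE[OF assms(1)] by blast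
  then show ?thesis
    by (intro CcI[of _ K]) (auto intro!: continuous_intros assms(2) Cc_continuous[OF assms(1)])
qed

lemma Cc_power2: "Cc f \<Longrightarrow> Cc (\<lambda>x. (f x)\<^sup>2)"
  using Cc_mult_left[of f f] by (simp add: Cc_continuous power2_eq_square)

lemma Cc_sqrt:
  assumes "Cc f" shows "Cc (\<lambda>x. sqrt (f x))"
proof -
  obtain K where "compact K" "\<And>x. f x \<noteq> 0 \<Longrightarrow> x \<in> K" using Cc_supportE[OF assms(1)] by blast
  then show ?thesis
    by (intro CcI[of _ K]) (auto intro!: continuous_intros Cc_continuous[OF assms])
qed

lemma Cc_abs:
  assumes "Cc f" shows "Cc (\<lambda>x. \<bar>f x\<bar>)"
  using Cc_sqrt[OF Cc_power2[OF assms]] by simp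

lemma Cc_add:
  assumes "Cc f" "Cc g" shows "Cc (\<lambda>x. f x + g x)"
proof -
  obtain K L where "compact K" "\<And>x. f x \<noteq> 0 \<Longrightarrow> x \<in> K" "compact L" "\<And>x. g x \<noteq> 0 \<Longrightarrow> x \<in> L"
    using Cc_supportE assms by metis
  then show ?thesis
    by (intro CcI[of _ "K \<union> L"] continuous_intros Cc_continuous[OF assms(1)] Cc_continuous[OF assms(2)] compact_Un)
      (simp_all, metis add.right_neutral add.left_neutral)
qed

lemma Cc_cmult: "Cc f \<Longrightarrow> Cc (\<lambda>x. c * f x)" for c :: real
  using Cc_mult_left[of f "\<lambda>_. c"] by (simp add: mult.commute)

lemma Cc_section:
  assumes "Cc F" shows "Cc (\<lambda>y. F (x, y))"
proof -
  obtain K where K: "compact K" "\<And>x. F x \<noteq> 0 \<Longrightarrow> x \<in> K" using Cc_supportE[OF assms] by blast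
  show ?thesis
  proof (rule CcI)
    show "continuous_on UNIV (\<lambda>y. F (x, y))"
      by (intro Cc_continuous_compose[OF assms] continuous_intros)
    show "compact (snd ` K)"
      by (intro compact_continuous_image K continuous_intros)
    show "y \<in> snd ` K" if "F (x, y) \<noteq> 0" for y
      using K(2)[OF that] by force
  qed
qed

lemma Cc_swap:
  assumes "Cc F" shows "Cc (\<lambda>(x, y). F (y, x))"
proof -
  obtain K where K: "compact K" "\<And>x. F x \<noteq> 0 \<Longrightarrow> x \<in> K" using Cc_supportE[OF assms] by blast
  show ?thesis
  proof (rule CcI)
    show "continuous_on UNIV (\<lambda>(x, y). F (y, x))"
      unfolding case_prod_beta by (intro Cc_continuous_compose[OF assms] continuous_intros)
    show "compact (prod.swap ` K)"
      by (intro compact_continuous_image K continuous_on_swap)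
    show "z \<in> prod.swap ` K" if "(\<lambda>(x, y). F (y, x)) z \<noteq> 0" for z
    proof -
      have "prod.swap z \<in> K" using that by (intro K(2)) (auto simp: case_prod_beta prod.swap_def)
      then show ?thesis by (metis image_eqI swap_swap)
    qed
  qed
qed

text \<open>Used to locate the support of a parameter integral inside a projection of the support of
  the integrand.\<close>

lemma integral_nonzero_imp:
  fixes f :: "'a \<Rightarrow> 'b::{banach,second_countable_topology}"
  assumes "(\<integral>y. f y \<partial>M) \<noteq> 0" shows "\<exists>y. f y \<noteq> 0"
proof (rule ccontr)
  assume "\<nexists>y. f y \<noteq> 0"
  then have "f = (\<lambda>_. 0)" by auto
  then show False using assms by simp
qed

section \<open>Integration of compactly supported functions against Haar measure\<close>

locale haar_group =
  fixes \<mu> :: "'g::{topological_group_add,t2_space} measure"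
  assumes lc: "locally_compact_group TYPE('g)"
    and haar: "right_haar_measure \<mu>"
begin

lemma sets_haar [simp, measurable_cong]: "sets \<mu> = sets borel"
  using haar by (simp add: right_haar_measure_def)

lemma space_haar [simp]: "space \<mu> = UNIV"
  using sets_eq_imp_space_eq[OF sets_haar] by simp

lemma emeasure_translate: "E \<in> sets borel \<Longrightarrow> emeasure \<mu> ((\<lambda>x. x + g) ` E) = emeasure \<mu> E"
  using haar[unfolded right_haar_measure_def, THEN conjunct2, THEN conjunct1] by simp

lemma emeasure_compact_finite: "compact K \<Longrightarrow> emeasure \<mu> K < \<infinity>"
  using haar[unfolded right_haar_measure_def, THEN conjunct2, THEN conjunct2, THEN conjunct1] by simp

lemma emeasure_open_pos: "open U \<Longrightarrow> U \<noteq> {} \<Longrightarrow> emeasure \<mu> U > 0"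
  using haar[unfolded right_haar_measure_def, THEN conjunct2, THEN conjunct2, THEN conjunct2, THEN conjunct1]
  by simp

lemma emeasure_outer_regular:
  "E \<in> sets borel \<Longrightarrow> emeasure \<mu> E = (INF U\<in>{U. open U \<and> E \<subseteq> U}. emeasure \<mu> U)"
  using haar[unfolded right_haar_measure_def, THEN conjunct2, THEN conjunct2, THEN conjunct2,
      THEN conjunct2, THEN conjunct1] by (rule bspec)

lemma emeasure_inner_regular:
  "open U \<Longrightarrow> emeasure \<mu> U = (SUP K\<in>{K. compact K \<and> K \<subseteq> U}. emeasure \<mu> K)"
  using haar[unfolded right_haar_measure_def, THEN conjunct2, THEN conjunct2, THEN conjunct2,
      THEN conjunct2, THEN conjunct2] by (elim allE impE)

lemma Cc_measurable: "Cc f \<Longrightarrow> f \<in> borel_measurable \<mu>"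
  using Cc_borel by (simp cong: measurable_cong_sets)

lemma integrable_indicator_compact: "compact K \<Longrightarrow> integrable \<mu> (indicator K :: 'g \<Rightarrow> real)"
  using emeasure_compact_finite[of K] by (auto intro!: integrable_real_indicator borel_compact)

lemma integrable_bounded_compact:
  fixes f :: "'g \<Rightarrow> real"
  assumes "f \<in> borel_measurable borel" "compact K" "\<And>x. \<bar>f x\<bar> \<le> B" "\<And>x. f x \<noteq> 0 \<Longrightarrow> x \<in> K"
  shows "integrable \<mu> f"
proof (rule Bochner_Integration.integrable_bound)
  show "integrable \<mu> (\<lambda>x. B * indicator K x)"
    using integrable_indicator_compact[OF assms(2)] by simp
  show "f \<in> borel_measurable \<mu>" using assms(1) by (simp cong: measurable_cong_sets)
  show "AE x in \<mu>. norm (f x) \<le> norm (B * indicator K x)"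
  proof (rule AE_I2)
    fix x show "norm (f x) \<le> norm (B * indicator K x)"
      using assms(3)[of x] assms(4)[of x] by (cases "f x = 0") auto
  qed
qed

lemma Cc_integrable: "Cc f \<Longrightarrow> integrable \<mu> f"
  by (metis Cc_borel Cc_bounded Cc_supportE integrable_bounded_compact)

text \<open>Compactness of \<open>C\<close> makes \<open>F (x, y)\<close> close to
  \<open>F (x0, y)\<close> uniformly in \<open>y\<close> near \<open>x0\<close>; this replaces
  dominated convergence, since the parameter space need not be sequential. The factor
  \<open>h\<close> is merely integrable so that it can be an indicator or a truncated length
  function.\<close>

lemma continuous_integral_param:
  fixes F :: "'a::topological_space \<times> 'g \<Rightarrow> real" and h :: "'g \<Rightarrow> real"
  assumes F: "continuous_on UNIV F" and C: "compact C"
    and h: "integrable \<mu> h" "\<And>y. h y \<noteq> 0 \<Longrightarrow> y \<in> C"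
  shows "continuous_on UNIV (\<lambda>x. \<integral>y. F (x, y) * h y \<partial>\<mu>)"
proof -
  have Fx: "continuous_on UNIV (\<lambda>y. F (x, y))" for x
    by (intro continuous_on_compose2[OF F] continuous_intros) auto
  have int: "integrable \<mu> (\<lambda>y. F (x, y) * h y)" for x
  proof -
    have "compact ((\<lambda>y. F (x, y)) ` C)"
      using C Fx compact_continuous_image continuous_on_subset by blast
    then obtain B where B: "\<forall>z\<in>(\<lambda>y. F (x, y)) ` C. \<bar>z\<bar> \<le> B"
      using compact_imp_bounded bounded_real by blast
    show ?thesis
    proof (rule Bochner_Integration.integrable_bound)
      show "integrable \<mu> (\<lambda>y. B * \<bar>h y\<bar>)" using h(1) by simp
      show "(\<lambda>y. F (x, y) * h y) \<in> borel_measurable \<mu>"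
        using borel_measurable_continuous_onI[OF Fx] h(1)
        by (intro borel_measurable_times) (auto cong: measurable_cong_sets)
      show "AE y in \<mu>. norm (F (x, y) * h y) \<le> norm (B * \<bar>h y\<bar>)"
      proof (rule AE_I2)
        fix y show "norm (F (x, y) * h y) \<le> norm (B * \<bar>h y\<bar>)"
        proof (cases "h y = 0")
          case False
          then have "\<bar>F (x, y)\<bar> \<le> B" using B h(2) by auto
          then show ?thesis by (simp add: abs_mult mult_right_mono)
        qed simp
      qed
    qed
  qed
  define I where "I = (\<integral>y. \<bar>h y\<bar> \<partial>\<mu>)"
  have I: "I \<ge> 0" by (simp add: I_def)
  show ?thesis
    unfolding continuous_on_def
  proof (intro ballI tendstoI)
    fix x0 and e :: real assume e: "e > 0"
    \<comment> \<open>The summand 1 covers the case that the integral of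
      \<open>\<bar>h\<bar>\<close> is zero.\<close>
    define e' where "e' = e / (I + 1)"
    have e': "e' > 0" "e' * I < e" using e I by (auto simp: e'_def field_simps)
    obtain X where X: "x0 \<in> X" "open X"
      "\<forall>x\<in>X \<inter> UNIV. \<forall>t\<in>C. dist (F (x, t)) (F (x0, t)) \<le> e'"
      using continuous_on_prod_compactE[of UNIV C F x0 e'] C e'(1) continuous_on_subset[OF F]
      by (metis UNIV_I subset_UNIV)
    have "dist (\<integral>y. F (x, y) * h y \<partial>\<mu>) (\<integral>y. F (x0, y) * h y \<partial>\<mu>) < e" if "x \<in> X" for x
    proof -
      have "\<bar>(\<integral>y. F (x, y) * h y \<partial>\<mu>) - (\<integral>y. F (x0, y) * h y \<partial>\<mu>)\<bar>
          = \<bar>\<integral>y. (F (x, y) - F (x0, y)) * h y \<partial>\<mu>\<bar>"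
        by (simp add: int left_diff_distrib)
      also have "\<dots> \<le> (\<integral>y. \<bar>(F (x, y) - F (x0, y)) * h y\<bar> \<partial>\<mu>)"
        by (rule integral_abs_bound)
      also have "\<dots> \<le> (\<integral>y. e' * \<bar>h y\<bar> \<partial>\<mu>)"
      proof (rule integral_mono)
        show "integrable \<mu> (\<lambda>y. \<bar>(F (x, y) - F (x0, y)) * h y\<bar>)"
          using int[of x] int[of x0] by (auto simp: left_diff_distrib)
        show "integrable \<mu> (\<lambda>y. e' * \<bar>h y\<bar>)" using h(1) by simp
        fix y show "\<bar>(F (x, y) - F (x0, y)) * h y\<bar> \<le> e' * \<bar>h y\<bar>"
        proof (cases "h y = 0")
          case False
          then have "\<bar>F (x, y) - F (x0, y)\<bar> \<le> e'" using X(3) that h(2) by (auto simp: dist_real_def)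
          then show ?thesis by (simp add: abs_mult mult_right_mono)
        qed simp
      qed
      also have "\<dots> < e" using e'(2) by (simp add: I_def)
      finally show ?thesis by (simp add: dist_real_def)
    qed
    then show "\<forall>\<^sub>F x in at x0 within UNIV.
        dist (\<integral>y. F (x, y) * h y \<partial>\<mu>) (\<integral>y. F (x0, y) * h y \<partial>\<mu>) < e"
      using X(1,2) by (auto simp: eventually_at_topological)
  qed
qed

lemma Cc_integral:
  fixes F :: "'a::t2_space \<times> 'g \<Rightarrow> real"
  assumes "Cc F" shows "Cc (\<lambda>x. \<integral>y. F (x, y) \<partial>\<mu>)"
proof -
  obtain K where K: "compact K" "\<And>z. F z \<noteq> 0 \<Longrightarrow> z \<in> K" using Cc_supportE[OF assms] by blast
  have c: "compact (fst ` K)" "compact (snd ` K)"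
    by (intro compact_continuous_image K continuous_intros)+
  \<comment> \<open>The indicator of the projected support changes nothing and supplies the
    integrable factor \<open>h\<close>.\<close>
  have eq: "(\<lambda>x. \<integral>y. F (x, y) \<partial>\<mu>) = (\<lambda>x. \<integral>y. F (x, y) * indicator (snd ` K) y \<partial>\<mu>)"
  proof (intro ext Bochner_Integration.integral_cong refl)
    fix x y show "F (x, y) = F (x, y) * indicator (snd ` K) y"
      using K(2)[of "(x, y)"] by (cases "F (x, y) = 0") (force simp: indicator_def)+
  qed
  have cont: "continuous_on UNIV (\<lambda>x. \<integral>y. F (x, y) \<partial>\<mu>)"
    unfolding eq
  proof (rule continuous_integral_param[OF Cc_continuous[OF assms] c(2) integrable_indicator_compact[OF c(2)]])
    show "y \<in> snd ` K" if "indicat_real (snd ` K) y \<noteq> 0" for y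
      using that by (metis indicator_simps(2))
  qed
  show ?thesis
  proof (rule CcI[OF cont c(1)])
    fix x assume "(\<integral>y. F (x, y) \<partial>\<mu>) \<noteq> 0"
    then obtain y where "F (x, y) \<noteq> 0"
      using integral_nonzero_imp by blast
    then show "x \<in> fst ` K" using K(2) by force
  qed
qed

section \<open>Measurability on the product and Fubini\<close>

lemma completely_regular: "completely_regular_space (euclidean :: 'g topology)"
proof (rule locally_compact_regular_imp_completely_regular_space)
  show "locally_compact_space (euclidean :: 'g topology)"
    using lc by (simp add: locally_compact_group_def)
  show "Hausdorff_space (euclidean :: 'g topology) \<or> regular_space (euclidean :: 'g topology)"
    by (simp add: Hausdorff_space_def disjnt_def separation_t2)
qed

lemma separate_points:
  assumes "x \<noteq> (y :: 'g)"
  obtains f :: "'g \<Rightarrow> real" where "continuous_on UNIV f" "f x \<noteq> f y"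
proof -
  obtain f where "continuous_map (euclidean :: 'g topology) euclideanreal f" "f ` {y} \<subseteq> {0}" "f ` {x} \<subseteq> {1}"
    using Urysohn_completely_regular_compact_closed_alt[OF completely_regular, of "{x}" "{y}" 0 1] assms
    by (auto simp: disjnt_def)
  then show thesis by (intro that[of f]) auto
qed

text \<open>Without second countability the Borel sigma-algebra of a product may exceed the product
  sigma-algebra, so measurability of continuous functions on the product comes from
  Stone-Weierstrass.\<close>

lemma Cc_pair_measurable:
  fixes F :: "'g \<times> 'g \<Rightarrow> real"
  assumes "Cc F" shows "F \<in> borel_measurable (borel \<Otimes>\<^sub>M borel)"
proof -
  obtain K0 where K0: "compact K0" "\<And>z. F z \<noteq> 0 \<Longrightarrow> z \<in> K0" using Cc_supportE[OF assms] by blast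
  \<comment> \<open>The support is enlarged to a rectangle of compact sets, because a general
    compact subset of the product need not belong to the product sigma-algebra.\<close>
  define K where "K = fst ` K0 \<times> snd ` K0"
  have cK: "compact (fst ` K0)" "compact (snd ` K0)"
    by (intro compact_continuous_image K0 continuous_intros)+
  then have K: "compact K" by (simp add: K_def compact_Times)
  have supp: "z \<in> K" if "F z \<noteq> 0" for z
    using K0(2)[OF that] by (force simp: K_def image_iff mem_Times_iff)
  \<comment> \<open>Both conditions are preserved by sums and products, and functions of a single
    coordinate satisfy both; these already separate the points of the product.\<close>
  define R where "R = {g :: 'g \<times> 'g \<Rightarrow> real. continuous_on UNIV g \<and> g \<in> borel_measurable (borel \<Otimes>\<^sub>M borel)}"
  interpret function_ring_on R K
  proof
    fix x y :: "'g \<times> 'g" assume "x \<noteq> y"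
    then consider "fst x \<noteq> fst y" | "snd x \<noteq> snd y" by (auto simp: prod_eq_iff)
    then show "\<exists>f\<in>R. f x \<noteq> f y"
    proof cases
      case 1
      then obtain f :: "'g \<Rightarrow> real" where f: "continuous_on UNIV f" "f (fst x) \<noteq> f (fst y)"
        using separate_points by blast
      have "f \<in> borel_measurable borel" using f(1) by (rule borel_measurable_continuous_onI)
      moreover have "continuous_on UNIV (\<lambda>z::'g \<times> 'g. f (fst z))"
        by (intro continuous_on_compose2[OF f(1)] continuous_intros) auto
      ultimately show ?thesis using f(2) unfolding R_def
        by (intro bexI[of _ "\<lambda>z. f (fst z)"]) auto
    next
      case 2
      then obtain f :: "'g \<Rightarrow> real" where f: "continuous_on UNIV f" "f (snd x) \<noteq> f (snd y)"
        using separate_points by blast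
      have "f \<in> borel_measurable borel" using f(1) by (rule borel_measurable_continuous_onI)
      moreover have "continuous_on UNIV (\<lambda>z::'g \<times> 'g. f (snd z))"
        by (intro continuous_on_compose2[OF f(1)] continuous_intros) auto
      ultimately show ?thesis using f(2) unfolding R_def
        by (intro bexI[of _ "\<lambda>z. f (snd z)"]) auto
    qed
  qed (use K in \<open>auto simp: R_def intro!: continuous_intros intro: continuous_on_subset\<close>)
  obtain G where G: "\<And>n. G n \<in> R" "uniform_limit K G F sequentially"
    using Stone_Weierstrass[of F] Cc_continuous[OF assms] continuous_on_subset by (metis PiE UNIV_I subset_UNIV)
  have KM: "K \<in> sets (borel \<Otimes>\<^sub>M borel)"
    unfolding K_def using cK by (intro pair_measureI borel_compact)
  \<comment> \<open>The approximation is uniform on \<open>K\<close> only; cutting off by the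
    indicator makes it converge everywhere, as \<open>F\<close> vanishes outside
    \<open>K\<close>.\<close>
  show ?thesis
  proof (rule borel_measurable_LIMSEQ_real)
    fix z assume "z \<in> space (borel \<Otimes>\<^sub>M borel :: ('g \<times> 'g) measure)"
    show "(\<lambda>n. G n z * indicator K z) \<longlonglongrightarrow> F z"
    proof (cases "z \<in> K")
      case True
      then show ?thesis using tendsto_uniform_limitI[OF G(2) True] by simp
    next
      case False
      then have "F z = 0" using supp by blast
      then show ?thesis using False by simp
    qed
  next
    fix n
    have "G n \<in> borel_measurable (borel \<Otimes>\<^sub>M borel)" using G(1) by (simp add: R_def)
    then show "(\<lambda>z. G n z * indicator K z) \<in> borel_measurable (borel \<Otimes>\<^sub>M borel)" 
      using KM by simp
  qed
qed

text \<open>Restricting \<mu> to a compact set containing both projections of the support gives a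
  finite measure, for which the ordinary theorem applies.\<close>

lemma Fubini_Cc:
  fixes F :: "'g \<times> 'g \<Rightarrow> real"
  assumes "Cc F"
  shows "(\<integral>x. \<integral>y. F (x, y) \<partial>\<mu> \<partial>\<mu>) = (\<integral>y. \<integral>x. F (x, y) \<partial>\<mu> \<partial>\<mu>)"
proof -
  obtain K where K: "compact K" "\<And>z. F z \<noteq> 0 \<Longrightarrow> z \<in> K" using Cc_supportE[OF assms] by blast
  define C where "C = fst ` K \<union> snd ` K"
  have C: "compact C" unfolding C_def
    by (intro compact_Un compact_continuous_image K continuous_intros)
  have supp: "x \<in> C \<and> y \<in> C" if "F (x, y) \<noteq> 0" for x y
    using K(2)[OF that] by (force simp: C_def)
  have Cm: "C \<in> sets borel" using C by (rule borel_compact)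
  define \<rho> where "\<rho> = density \<mu> (indicator C)"
  have [measurable_cong]: "sets \<rho> = sets borel" by (simp add: \<rho>_def)
  have fin: "finite_measure \<rho>"
  proof
    have "emeasure \<rho> (space \<rho>) = emeasure \<mu> C"
      using Cm by (simp add: \<rho>_def emeasure_density)
    then show "emeasure \<rho> (space \<rho>) \<noteq> \<infinity>" using emeasure_compact_finite[OF C] by simp
  qed
  interpret finite_measure \<rho> by fact
  interpret pair_sigma_finite \<rho> \<rho> ..
  obtain B where B: "\<And>z. \<bar>F z\<bar> \<le> B" using Cc_bounded[OF assms] by blast
  \<comment> \<open>This exchanges \<rho> and \<mu> in one integral at a time, so each partial
    integral needs its support checked.\<close>
  have 1: "(\<integral>y. f y \<partial>\<rho>) = (\<integral>y. f y \<partial>\<mu>)" if "Cc f" "\<And>y. f y \<noteq> 0 \<Longrightarrow> y \<in> C" for f :: "'g \<Rightarrow> real"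
  proof -
    have "(\<integral>y. f y \<partial>\<rho>) = (\<integral>y. f y \<partial>density \<mu> (\<lambda>x. ennreal (indicator C x)))"
      unfolding \<rho>_def by (simp add: ennreal_indicator)
    also have "\<dots> = (\<integral>y. indicator C y * f y \<partial>\<mu>)"
      using Cm Cc_measurable[OF that(1)] by (subst integral_density) auto
    also have "\<dots> = (\<integral>y. f y \<partial>\<mu>)"
      using that(2) by (intro Bochner_Integration.integral_cong) (force simp: indicator_def)+
    finally show ?thesis .
  qed
  have F2: "Cc (\<lambda>x. F (x, y))" for y using Cc_section[OF Cc_swap[OF assms], of y] by simp
  have int: "integrable (\<rho> \<Otimes>\<^sub>M \<rho>) (\<lambda>(x, y). F (x, y))"
  proof -
    have "finite_measure (\<rho> \<Otimes>\<^sub>M \<rho>)" using fin finite_measure_pair_measure by blast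
    then show ?thesis using Cc_pair_measurable[OF assms] B
      by (intro finite_measure.integrable_const_bound[where B=B]) auto
  qed
  have "(\<integral>x. \<integral>y. F (x, y) \<partial>\<mu> \<partial>\<mu>) = (\<integral>x. \<integral>y. F (x, y) \<partial>\<mu> \<partial>\<rho>)"
    using supp by (intro 1[symmetric] Cc_integral assms) (drule integral_nonzero_imp, auto)
  also have "\<dots> = (\<integral>x. \<integral>y. F (x, y) \<partial>\<rho> \<partial>\<rho>)"
    using supp by (intro Bochner_Integration.integral_cong 1[symmetric] Cc_section assms) auto
  also have "\<dots> = (\<integral>y. \<integral>x. F (x, y) \<partial>\<rho> \<partial>\<rho>)"
    using Fubini_integral[OF int] by simp
  also have "\<dots> = (\<integral>y. \<integral>x. F (x, y) \<partial>\<mu> \<partial>\<rho>)"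
    using supp by (intro Bochner_Integration.integral_cong 1 F2) auto
  also have "\<dots> = (\<integral>y. \<integral>x. F (x, y) \<partial>\<mu> \<partial>\<mu>)"
  proof (rule 1)
    show "Cc (\<lambda>y. \<integral>x. F (x, y) \<partial>\<mu>)"
      using Cc_integral[OF Cc_swap[OF assms]] by simp
    show "y \<in> C" if "(\<integral>x. F (x, y) \<partial>\<mu>) \<noteq> 0" for y
      using integral_nonzero_imp[OF that] supp by auto
  qed
  finally show ?thesis .
qed

lemma measurable_translate: "(\<lambda>x. x + g) \<in> measurable \<mu> borel"
proof -
  have "(\<lambda>x::'g. x + g) \<in> borel_measurable borel"
    by (intro borel_measurable_continuous_onI continuous_intros)
  then show ?thesis by (simp cong: measurable_cong_sets)
qed

lemma distr_translate: "distr \<mu> borel (\<lambda>x. x + g) = \<mu>"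
proof (rule measure_eqI)
  fix E assume "E \<in> sets (distr \<mu> borel (\<lambda>x. x + g))"
  then have E: "E \<in> sets borel" by simp
  have eq: "(\<lambda>x. x + g) -` E = (\<lambda>x. x + - g) ` E"
  proof (intro equalityI subsetI)
    fix x assume "x \<in> (\<lambda>x. x + g) -` E"
    then have "x + g \<in> E" by simp
    then show "x \<in> (\<lambda>x. x + - g) ` E" by (rule rev_image_eqI) (simp add: add.assoc)
  qed (auto simp: add.assoc)
  have "emeasure (distr \<mu> borel (\<lambda>x. x + g)) E = emeasure \<mu> ((\<lambda>x. x + - g) ` E)"
    using E measurable_translate by (simp add: emeasure_distr eq)
  also have "\<dots> = emeasure \<mu> E" by (rule emeasure_translate[OF E])
  finally show "emeasure (distr \<mu> borel (\<lambda>x. x + g)) E = emeasure \<mu> E" .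
qed simp

lemma integral_translate:
  fixes f :: "'g \<Rightarrow> real"
  assumes "f \<in> borel_measurable borel"
  shows "(\<integral>x. f (x + g) \<partial>\<mu>) = (\<integral>x. f x \<partial>\<mu>)"
  using integral_distr[OF measurable_translate assms, of g] by (simp add: distr_translate)

end

section \<open>Convolution and averaging\<close>

lemma Cc_pair_comp:
  fixes p :: "'a::topological_space \<Rightarrow> 'b::topological_space" and q :: "'a \<Rightarrow> 'c::topological_space"
  assumes f: "Cc f" and g: "Cc g"
    and cont: "continuous_on UNIV p" "continuous_on UNIV q" "continuous_on UNIV m"
    and m: "\<And>z. m (p z, q z) = z"
  shows "Cc (\<lambda>z. f (p z) * g (q z))"
proof -
  obtain K where K: "compact K" "\<And>x. f x \<noteq> 0 \<Longrightarrow> x \<in> K" using Cc_supportE[OF f] by blast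
  obtain L where L: "compact L" "\<And>x. g x \<noteq> 0 \<Longrightarrow> x \<in> L" using Cc_supportE[OF g] by blast
  show ?thesis
  proof (rule CcI)
    show "continuous_on UNIV (\<lambda>z. f (p z) * g (q z))"
      by (intro continuous_on_mult Cc_continuous_compose[OF f] Cc_continuous_compose[OF g] cont)
    show "compact (m ` (K \<times> L))"
      using K L cont(3) by (intro compact_continuous_image compact_Times) (auto intro: continuous_on_subset)
    show "z \<in> m ` (K \<times> L)" if "f (p z) * g (q z) \<noteq> 0" for z
      using that K(2)[of "p z"] L(2)[of "q z"] m[of z, symmetric] by auto
  qed
qed

lemma Cc_conv_kernel:
  fixes f g :: "'g::topological_group_add \<Rightarrow> real"
  assumes "Cc f" "Cc g" shows "Cc (\<lambda>(x, y). f (x - y) * g y)"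
  unfolding case_prod_beta
  by (rule Cc_pair_comp[OF assms, of "\<lambda>z. fst z - snd z" "\<lambda>z. snd z" "\<lambda>z. (fst z + snd z, snd z)"])
    (auto intro!: continuous_intros)

lemma Cc_conv_kernel':
  fixes f g :: "'g::topological_group_add \<Rightarrow> real"
  assumes "Cc f" "Cc g" shows "Cc (\<lambda>(x, y). f y * g (x - y))"
  unfolding case_prod_beta
  by (rule Cc_pair_comp[OF assms, of "\<lambda>z. snd z" "\<lambda>z. fst z - snd z" "\<lambda>z. (snd z + fst z, fst z)"])
    (auto intro!: continuous_intros)

lemma Cc_corr_kernel:
  fixes f g :: "'g::topological_group_add \<Rightarrow> real"
  assumes "Cc f" "Cc g" shows "Cc (\<lambda>(x, y). f y * g (y + x))"
  unfolding case_prod_beta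
  by (rule Cc_pair_comp[OF assms, of "\<lambda>z. snd z" "\<lambda>z. snd z + fst z" "\<lambda>z. (- fst z + snd z, fst z)"])
    (auto intro!: continuous_intros simp: add.assoc[symmetric])

lemma Cc_corr_kernel':
  fixes f g :: "'g::topological_group_add \<Rightarrow> real"
  assumes "Cc f" "Cc g" shows "Cc (\<lambda>(x, y). f (y - x) * g y)"
  unfolding case_prod_beta
  by (rule Cc_pair_comp[OF assms, of "\<lambda>z. snd z - fst z" "\<lambda>z. snd z" "\<lambda>z. (- fst z + snd z, snd z)"])
    (auto intro!: continuous_intros simp: minus_diff_eq diff_add_cancel)

lemma Cc_tensor:
  assumes "Cc f" "Cc g" shows "Cc (\<lambda>(x, y). f x * g y)"
  unfolding case_prod_beta
  by (rule Cc_pair_comp[OF assms, of "\<lambda>z. fst z" "\<lambda>z. snd z" "\<lambda>z. z"])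
    (auto intro!: continuous_intros)

lemma Cc_translate:
  fixes f :: "'g::topological_group_add \<Rightarrow> real"
  assumes "Cc f" shows "Cc (\<lambda>x. f (x + a))" "Cc (\<lambda>x. f (a - x))" "Cc (\<lambda>x. f (a + x))"
proof -
  obtain K where K: "compact K" "\<And>x. f x \<noteq> 0 \<Longrightarrow> x \<in> K" using Cc_supportE[OF assms] by blast
  have "x \<in> (\<lambda>k. k - a) ` K" if "f (x + a) \<noteq> 0" for x
    using K(2)[OF that] by (rule rev_image_eqI) simp
  then show "Cc (\<lambda>x. f (x + a))"
    by (intro CcI[where K="(\<lambda>k. k - a) ` K"] compact_continuous_image K(1) Cc_continuous_compose[OF assms] continuous_intros)
  have "x \<in> (\<lambda>k. - k + a) ` K" if "f (a - x) \<noteq> 0" for x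
    using K(2)[OF that] by (rule rev_image_eqI) (simp add: minus_diff_eq)
  then show "Cc (\<lambda>x. f (a - x))"
    by (intro CcI[where K="(\<lambda>k. - k + a) ` K"] compact_continuous_image K(1) Cc_continuous_compose[OF assms] continuous_intros)
  have "x \<in> (\<lambda>k. - a + k) ` K" if "f (a + x) \<noteq> 0" for x
    using K(2)[OF that] by (rule rev_image_eqI) (simp add: add.assoc[symmetric])
  then show "Cc (\<lambda>x. f (a + x))"
    by (intro CcI[where K="(\<lambda>k. - a + k) ` K"] compact_continuous_image K(1) Cc_continuous_compose[OF assms] continuous_intros)
qed

text \<open>The quadratic polynomial in \<open>t\<close> given by the weighted integral of
  \<open>(t * a x - b x)\<close> squared is nonnegative; evaluate it at its minimiser
  \<open>X / A\<close>.\<close>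

lemma weighted_Cauchy_Schwarz:
  fixes w a b :: "'a \<Rightarrow> real"
  assumes w: "\<And>x. w x \<ge> 0"
    and int: "integrable M (\<lambda>x. w x * (a x)\<^sup>2)" "integrable M (\<lambda>x. w x * (b x)\<^sup>2)"
      "integrable M (\<lambda>x. w x * (a x * b x))"
  shows "(\<integral>x. w x * (a x * b x) \<partial>M) \<le> sqrt (\<integral>x. w x * (a x)\<^sup>2 \<partial>M) * sqrt (\<integral>x. w x * (b x)\<^sup>2 \<partial>M)"
proof -
  define A B X where "A = (\<integral>x. w x * (a x)\<^sup>2 \<partial>M)" and "B = (\<integral>x. w x * (b x)\<^sup>2 \<partial>M)"
    and "X = (\<integral>x. w x * (a x * b x) \<partial>M)"
  have q: "0 \<le> t\<^sup>2 * A - 2 * t * X + B" for t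
  proof -
    have "0 \<le> (\<integral>x. w x * (t * a x - b x)\<^sup>2 \<partial>M)" using w by simp
    also have "\<dots> = (\<integral>x. t\<^sup>2 * (w x * (a x)\<^sup>2) - 2 * t * (w x * (a x * b x)) + w x * (b x)\<^sup>2 \<partial>M)"
      by (intro Bochner_Integration.integral_cong refl) (simp add: power2_eq_square algebra_simps)
    also have "\<dots> = t\<^sup>2 * A - 2 * t * X + B" using int by (simp add: A_def B_def X_def)
    finally show ?thesis .
  qed
  have AB: "A \<ge> 0" "B \<ge> 0" using w by (simp_all add: A_def B_def)
  have "X\<^sup>2 \<le> A * B"
  proof (cases "A = 0")
    case True
    have "X = 0"
    proof (rule ccontr)
      assume "X \<noteq> 0"
      \<comment> \<open>For \<open>A = 0\<close> the polynomial is affine, and at this point it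
        takes the value -1.\<close>
      then show False using q[of "(B + 1) / (2 * X)"] True by simp
    qed
    then show ?thesis using True by simp
  next
    case False
    then have "A > 0" using AB by simp
    then show ?thesis using q[of "X / A"] by (simp add: power2_eq_square field_simps)
  qed
  then have "X \<le> sqrt (A * B)" using real_le_rsqrt by blast
  then show ?thesis by (simp add: real_sqrt_mult A_def B_def X_def)
qed

context haar_group
begin

definition conv :: "('g \<Rightarrow> real) \<Rightarrow> ('g \<Rightarrow> real) \<Rightarrow> 'g \<Rightarrow> real" where
  "conv f \<xi> x = (\<integral>y. f (x - y) * \<xi> y \<partial>\<mu>)"

text \<open>A correlation rather than a convolution: the weight \<psi> sits at the factor
  multiplying the argument from the left. This is what later brings in the integral of
  \<open>\<psi> (- y)\<close>.\<close>

definition smear :: "('g \<Rightarrow> real) \<Rightarrow> ('g \<Rightarrow> real) \<Rightarrow> 'g \<Rightarrow> real" where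
  "smear \<psi> F y = (\<integral>v. \<psi> v * F (v + y) \<partial>\<mu>)"

text \<open>As a function this is \<open>conv F \<psi>\<close>; the separate name marks its role as
  an average over right translates.\<close>

definition rsmear :: "('g \<Rightarrow> real) \<Rightarrow> ('g \<Rightarrow> real) \<Rightarrow> 'g \<Rightarrow> real" where
  "rsmear \<psi> F t = (\<integral>v. \<psi> v * F (t - v) \<partial>\<mu>)"

lemma Cc_conv: "Cc f \<Longrightarrow> Cc g \<Longrightarrow> Cc (conv f g)"
  using Cc_integral[OF Cc_conv_kernel] by (simp add: conv_def[abs_def])

lemma Cc_smear: "Cc f \<Longrightarrow> Cc g \<Longrightarrow> Cc (smear f g)"
  using Cc_integral[OF Cc_corr_kernel] by (simp add: smear_def[abs_def])

lemma Cc_rsmear: "Cc f \<Longrightarrow> Cc g \<Longrightarrow> Cc (rsmear f g)"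
  using Cc_integral[OF Cc_conv_kernel'] by (simp add: rsmear_def[abs_def])

text \<open>Right invariance alone gives this: substituting \<open>v - y\<close> for \<open>v\<close> and exchanging the
  integrals leaves an inner integral over \<open>y\<close> that does not depend on \<open>v\<close>. The modular function
  never enters.\<close>

lemma integral_smear:
  assumes "Cc \<psi>" "Cc F"
  shows "(\<integral>y. smear \<psi> F y \<partial>\<mu>) = (\<integral>y. \<psi> (- y) \<partial>\<mu>) * (\<integral>y. F y \<partial>\<mu>)"
proof -
  have c: "Cc (\<lambda>v. \<psi> (v - y) * F v)" for y
    using Cc_section[OF Cc_corr_kernel'[OF assms], of y] by simp
  have n: "Cc (\<lambda>y. \<psi> (- y))" using Cc_translate(2)[OF assms(1), of 0] by simp
  have "smear \<psi> F y = (\<integral>v. \<psi> (v - y) * F v \<partial>\<mu>)" for y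
    using integral_translate[OF Cc_borel[OF c[of y]], of y] by (simp add: smear_def)
  then have "(\<integral>y. smear \<psi> F y \<partial>\<mu>) = (\<integral>y. \<integral>v. \<psi> (v - y) * F v \<partial>\<mu> \<partial>\<mu>)" by simp
  also have "\<dots> = (\<integral>v. \<integral>y. \<psi> (v - y) * F v \<partial>\<mu> \<partial>\<mu>)"
    using Fubini_Cc[OF Cc_corr_kernel'[OF assms]] by simp
  also have "\<dots> = (\<integral>v. (\<integral>y. \<psi> (- y) \<partial>\<mu>) * F v \<partial>\<mu>)"
  proof (intro Bochner_Integration.integral_cong refl)
    fix v
    have "(\<integral>y. \<psi> (v - y) \<partial>\<mu>) = (\<integral>y. \<psi> (- y) \<partial>\<mu>)"
      using integral_translate[OF Cc_borel[OF n], of "- v"] by (simp add: minus_add)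
    then show "(\<integral>y. \<psi> (v - y) * F v \<partial>\<mu>) = (\<integral>y. \<psi> (- y) \<partial>\<mu>) * F v" by simp
  qed
  also have "\<dots> = (\<integral>y. \<psi> (- y) \<partial>\<mu>) * (\<integral>y. F y \<partial>\<mu>)" by simp
  finally show ?thesis .
qed

text \<open>Each right translate of \<open>F\<close> has the integral of \<open>F\<close>, so only
  the total mass of \<psi> appears. It may differ from the constant of \<open>integral_smear\<close>
  when the group is not unimodular.\<close>

lemma integral_rsmear:
  assumes "Cc \<psi>" "Cc F"
  shows "(\<integral>y. rsmear \<psi> F y \<partial>\<mu>) = (\<integral>y. \<psi> y \<partial>\<mu>) * (\<integral>y. F y \<partial>\<mu>)"
proof -
  have "(\<integral>y. rsmear \<psi> F y \<partial>\<mu>) = (\<integral>v. \<integral>y. \<psi> v * F (y - v) \<partial>\<mu> \<partial>\<mu>)"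
    using Fubini_Cc[OF Cc_conv_kernel'[OF assms]] by (simp add: rsmear_def)
  also have "\<dots> = (\<integral>v. \<psi> v * (\<integral>y. F y \<partial>\<mu>) \<partial>\<mu>)"
    using integral_translate[OF Cc_borel[OF assms(2)], of "- v" for v] by simp
  finally show ?thesis by simp
qed

lemma smear_nonneg: "(\<And>x. \<psi> x \<ge> 0) \<Longrightarrow> (\<And>x. F x \<ge> 0) \<Longrightarrow> smear \<psi> F y \<ge> 0"
  by (simp add: smear_def)

lemma rsmear_nonneg: "(\<And>x. \<psi> x \<ge> 0) \<Longrightarrow> (\<And>x. F x \<ge> 0) \<Longrightarrow> rsmear \<psi> F y \<ge> 0"
  by (simp add: rsmear_def)

lemma conv_nonneg: "(\<And>x. \<psi> x \<ge> 0) \<Longrightarrow> (\<And>x. F x \<ge> 0) \<Longrightarrow> conv \<psi> F y \<ge> 0"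
  by (simp add: conv_def)

text \<open>Minkowski's integral inequality combined with Cauchy-Schwarz; the square roots play the
  role of the averages of \<open>f\<close> over two-sided and of \<open>\<xi>\<close> over left translates.\<close>

lemma smear_conv_le:
  assumes \<psi>: "Cc \<psi>" "\<And>x. \<psi> x \<ge> 0" and f: "Cc f" "\<And>x. f x \<ge> 0" and \<xi>: "Cc \<xi>" "\<And>x. \<xi> x \<ge> 0"
  defines "P \<equiv> rsmear \<psi> (\<lambda>x. (f x)\<^sup>2)"
  defines "R \<equiv> smear \<psi> P"
    and "Q \<equiv> smear \<psi> (\<lambda>x. (\<xi> x)\<^sup>2)"
  shows "(\<integral>y. \<psi> (- y) \<partial>\<mu>) * sqrt (smear \<psi> (\<lambda>x. (conv f \<xi> x)\<^sup>2) x)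
    \<le> conv (\<lambda>x. sqrt (R x)) (\<lambda>x. sqrt (Q x)) x"
proof -
  define \<kappa> where "\<kappa> = (\<integral>y. \<psi> (- y) \<partial>\<mu>)"
  define g where "g = conv f \<xi>"
  define B where "B = smear \<psi> (\<lambda>x. (g x)\<^sup>2) x"
  have g: "Cc g" "\<And>x. g x \<ge> 0" using f \<xi> by (auto simp: g_def intro!: Cc_conv conv_nonneg)
  have P: "Cc P" "\<And>x. P x \<ge> 0" using f \<psi> by (auto simp: P_def intro!: Cc_rsmear rsmear_nonneg Cc_power2)
  have R: "Cc R" "\<And>x. R x \<ge> 0" using P \<psi> by (auto simp: R_def intro!: Cc_smear smear_nonneg)
  have Q: "Cc Q" "\<And>x. Q x \<ge> 0" using \<xi> \<psi> by (auto simp: Q_def intro!: Cc_smear smear_nonneg Cc_power2)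
  have B0: "B \<ge> 0" using \<psi> by (auto simp: B_def intro!: smear_nonneg)
  \<comment> \<open>\<open>D u\<close> is the smeared integrand of \<open>g (u + x)\<close>: by
    \<open>integral_smear\<close>, smearing multiplies the integral by \<kappa> only.\<close>
  define D where "D u = smear \<psi> (\<lambda>t. f (u + x - t) * \<xi> t)" for u
  have cD: "Cc (\<lambda>t. f (u + x - t) * \<xi> t)" for u
    using Cc_section[OF Cc_conv_kernel[OF f(1) \<xi>(1)], of "u + x"] by simp
  have D: "Cc (D u)" for u unfolding D_def by (rule Cc_smear[OF \<psi>(1) cD])
  have kg: "\<kappa> * g (u + x) = (\<integral>y. D u y \<partial>\<mu>)" for u
    unfolding D_def integral_smear[OF \<psi>(1) cD] by (simp add: \<kappa>_def g_def conv_def)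
  have D_le: "D u y \<le> sqrt (P (u + x - y)) * sqrt (Q y)" for u y
  proof -
    have i1: "Cc (\<lambda>v. f (u + x - y - v))" and i2: "Cc (\<lambda>v. \<xi> (v + y))"
      using Cc_translate(2)[OF f(1), of "u + x - y"] Cc_translate(1)[OF \<xi>(1)] by auto
    \<comment> \<open>At \<open>t = v + y\<close> the variable \<open>v\<close> separates the two
      factors, so Cauchy-Schwarz in \<open>v\<close> produces exactly \<open>P\<close> and
      \<open>Q\<close>.\<close>
    have "D u y = (\<integral>v. \<psi> v * (f (u + x - y - v) * \<xi> (v + y)) \<partial>\<mu>)"
      by (simp add: D_def smear_def diff_conv_add_uminus minus_add add.assoc del: add_uminus_conv_diff)
    also have "\<dots> \<le> sqrt (\<integral>v. \<psi> v * (f (u + x - y - v))\<^sup>2 \<partial>\<mu>) * sqrt (\<integral>v. \<psi> v * (\<xi> (v + y))\<^sup>2 \<partial>\<mu>)"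
      by (intro weighted_Cauchy_Schwarz \<psi>(2) Cc_integrable Cc_mult_left[OF \<psi>(1)] continuous_intros
          Cc_continuous[OF i1] Cc_continuous[OF i2])
    finally show ?thesis by (simp add: P_def Q_def rsmear_def smear_def)
  qed
  have cg: "continuous_on UNIV (\<lambda>u. g (u + x))" and cP: "continuous_on UNIV (\<lambda>u. sqrt (P (u + x - y)))" for y
    by (intro continuous_intros Cc_continuous_compose[OF g(1)] Cc_continuous_compose[OF P(1)])+
  define E where "E = (\<lambda>(u, y). (\<psi> u * sqrt (Q y)) * (g (u + x) * sqrt (P (u + x - y))))"
  have E: "Cc E"
    unfolding E_def case_prod_beta
    by (intro Cc_mult_left[where f="\<lambda>z. \<psi> (fst z) * sqrt (Q (snd z))"]
        Cc_tensor[OF \<psi>(1) Cc_sqrt[OF Q(1)], unfolded case_prod_beta] continuous_intros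
        Cc_continuous_compose[OF g(1)] Cc_continuous_compose[OF P(1)])
  \<comment> \<open>The duality argument for Minkowski: of the square \<open>g * g\<close> only one
    factor is expanded as an integral over \<open>y\<close>, the other is kept and paired with it in
    \<open>u\<close>.\<close>
  have "\<kappa> * B = (\<integral>u. \<psi> u * g (u + x) * (\<kappa> * g (u + x)) \<partial>\<mu>)"
    unfolding B_def smear_def by (subst integral_mult_right_zero[symmetric])
      (intro Bochner_Integration.integral_cong refl, simp add: power2_eq_square)
  also have "\<dots> = (\<integral>u. \<psi> u * g (u + x) * (\<integral>y. D u y \<partial>\<mu>) \<partial>\<mu>)" by (simp add: kg)
  also have "\<dots> \<le> (\<integral>u. \<integral>y. E (u, y) \<partial>\<mu> \<partial>\<mu>)"
  proof (rule integral_mono)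
    show "integrable \<mu> (\<lambda>u. \<psi> u * g (u + x) * (\<integral>y. D u y \<partial>\<mu>))"
      unfolding kg[symmetric] mult.assoc
      by (intro Cc_integrable Cc_mult_left[OF \<psi>(1)] continuous_intros cg)
    show "integrable \<mu> (\<lambda>u. \<integral>y. E (u, y) \<partial>\<mu>)" by (intro Cc_integrable Cc_integral E)
    fix u
    have "\<psi> u * g (u + x) * (\<integral>y. D u y \<partial>\<mu>) = (\<integral>y. \<psi> u * g (u + x) * D u y \<partial>\<mu>)" by simp
    also have "\<dots> \<le> (\<integral>y. E (u, y) \<partial>\<mu>)"
    proof (rule integral_mono)
      show "integrable \<mu> (\<lambda>y. \<psi> u * g (u + x) * D u y)" by (intro Cc_integrable Cc_cmult D)
      show "integrable \<mu> (\<lambda>y. E (u, y))" by (intro Cc_integrable Cc_section E)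
      fix y
      have "\<psi> u * g (u + x) * D u y \<le> \<psi> u * g (u + x) * (sqrt (P (u + x - y)) * sqrt (Q y))"
        using D_le \<psi>(2) g(2) by (intro mult_left_mono) auto
      then show "\<psi> u * g (u + x) * D u y \<le> E (u, y)" by (simp add: E_def mult_ac)
    qed
    finally show "\<psi> u * g (u + x) * (\<integral>y. D u y \<partial>\<mu>) \<le> (\<integral>y. E (u, y) \<partial>\<mu>)" .
  qed
  also have "\<dots> = (\<integral>y. \<integral>u. E (u, y) \<partial>\<mu> \<partial>\<mu>)" by (rule Fubini_Cc[OF E])
  also have "\<dots> \<le> (\<integral>y. sqrt B * (sqrt (R (x - y)) * sqrt (Q y)) \<partial>\<mu>)"
  proof (rule integral_mono)
    show "integrable \<mu> (\<lambda>y. \<integral>u. E (u, y) \<partial>\<mu>)"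
      using Cc_integrable[OF Cc_integral[OF Cc_swap[OF E]]] by simp
    show "integrable \<mu> (\<lambda>y. sqrt B * (sqrt (R (x - y)) * sqrt (Q y)))"
      using Cc_section[OF Cc_conv_kernel[OF Cc_sqrt[OF R(1)] Cc_sqrt[OF Q(1)]], of x]
      by (intro Cc_integrable Cc_cmult) simp
    fix y
    have "(\<integral>u. E (u, y) \<partial>\<mu>) = sqrt (Q y) * (\<integral>u. \<psi> u * (g (u + x) * sqrt (P (u + x - y))) \<partial>\<mu>)"
      unfolding E_def by (subst integral_mult_right_zero[symmetric])
        (intro Bochner_Integration.integral_cong refl, simp add: mult_ac)
    also have "\<dots> \<le> sqrt (Q y) * (sqrt (\<integral>u. \<psi> u * (g (u + x))\<^sup>2 \<partial>\<mu>) * sqrt (\<integral>u. \<psi> u * (sqrt (P (u + x - y)))\<^sup>2 \<partial>\<mu>))"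
      using Q(2) by (intro mult_left_mono weighted_Cauchy_Schwarz \<psi>(2) Cc_integrable
          Cc_mult_left[OF \<psi>(1)] continuous_intros cg cP) auto
    also have "\<dots> = sqrt B * (sqrt (R (x - y)) * sqrt (Q y))"
      using P(2) by (simp add: B_def R_def smear_def add_diff_eq)
    finally show "(\<integral>u. E (u, y) \<partial>\<mu>) \<le> sqrt B * (sqrt (R (x - y)) * sqrt (Q y))" .
  qed
  also have "\<dots> = sqrt B * conv (\<lambda>x. sqrt (R x)) (\<lambda>x. sqrt (Q x)) x" by (simp add: conv_def)
  \<comment> \<open>One factor \<open>sqrt B\<close> cancels unless \<open>B = 0\<close>, where the
    claim is just nonnegativity of the right side.\<close>
  finally have "sqrt B * (\<kappa> * sqrt B) \<le> sqrt B * conv (\<lambda>x. sqrt (R x)) (\<lambda>x. sqrt (Q x)) x"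
    using B0 by (simp add: mult_ac)
  moreover have "0 \<le> conv (\<lambda>x. sqrt (R x)) (\<lambda>x. sqrt (Q x)) x" using R Q by (intro conv_nonneg) auto
  ultimately have "\<kappa> * sqrt B \<le> conv (\<lambda>x. sqrt (R x)) (\<lambda>x. sqrt (Q x)) x"
    using B0 by (cases "B = 0") auto
  then show ?thesis by (simp add: \<kappa>_def B_def g_def)
qed

lemma smear_left_invariant:
  assumes "Cc \<psi>" "Cc F" "\<And>v. \<psi> (v + h) = \<psi> v"
  shows "smear \<psi> F (h + y) = smear \<psi> F y"
proof -
  have "smear \<psi> F (h + y) = (\<integral>v. \<psi> (v + h) * F (v + h + y) \<partial>\<mu>)"
    using assms(3) by (simp add: smear_def add.assoc)
  also have "\<dots> = smear \<psi> F y"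
    unfolding smear_def using assms
    by (intro integral_translate[where f="\<lambda>v. \<psi> v * F (v + y)"] Cc_borel Cc_mult_left
        Cc_continuous_compose[OF assms(2)] continuous_intros)
  finally show ?thesis .
qed

text \<open>The integration variable enters \<open>F\<close> through its inverse, so translating
  \<open>v\<close> on its right by \<open>h\<close> places the inverse of \<open>h\<close> directly
  after \<open>t\<close>.\<close>

lemma rsmear_right_invariant:
  assumes "Cc \<psi>" "Cc F" "\<And>v. \<psi> (v + h) = \<psi> v"
  shows "rsmear \<psi> F (t - h) = rsmear \<psi> F t"
proof -
  have "rsmear \<psi> F t = (\<integral>v. \<psi> (v + h) * F (t - (v + h)) \<partial>\<mu>)"
    unfolding rsmear_def
    by (intro integral_translate[where f="\<lambda>v. \<psi> v * F (t - v)", symmetric] Cc_borel Cc_mult_left assms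
        Cc_continuous_compose[OF assms(2)] continuous_intros)
  also have "\<dots> = rsmear \<psi> F (t - h)"
    using assms(3) by (simp add: rsmear_def diff_conv_add_uminus minus_add add.assoc del: add_uminus_conv_diff)
  finally show ?thesis by simp
qed

end

section \<open>Bump functions, smoothing and density\<close>

text \<open>By compactness the functions \<open>F (x, t)\<close> and \<open>F (x0, t)\<close> of
  \<open>t\<close> are uniformly close for \<open>x\<close> near \<open>x0\<close>, and suprema of
  uniformly close functions are close.\<close>

lemma continuous_on_SUP_param:
  fixes F :: "'a::topological_space \<times> 'b::topological_space \<Rightarrow> real"
  assumes F: "continuous_on UNIV F" and C: "compact C" "C \<noteq> {}"
  shows "continuous_on UNIV (\<lambda>x. SUP t\<in>C. F (x, t))"
  unfolding continuous_on_def
proof (intro ballI tendstoI)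
  fix x0 and e :: real assume e: "e > 0"
  have bdd: "bdd_above ((\<lambda>t. F (x, t)) ` C)" for x
  proof -
    have "continuous_on C (\<lambda>t. F (x, t))"
      by (intro continuous_on_compose2[OF F] continuous_intros) auto
    then have "compact ((\<lambda>t. F (x, t)) ` C)" using C(1) compact_continuous_image by blast
    then show ?thesis by (intro bounded_imp_bdd_above compact_imp_bounded)
  qed
  obtain X where X: "x0 \<in> X" "open X" "\<forall>x\<in>X \<inter> UNIV. \<forall>t\<in>C. dist (F (x, t)) (F (x0, t)) \<le> e / 2"
    using continuous_on_prod_compactE[of UNIV C F x0 "e / 2"] C e continuous_on_subset[OF F]
    by (metis UNIV_I subset_UNIV half_gt_zero)
  have "dist (SUP t\<in>C. F (x, t)) (SUP t\<in>C. F (x0, t)) < e" if "x \<in> X" for x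
  proof -
    have d: "\<bar>F (x, t) - F (x0, t)\<bar> \<le> e / 2" if "t \<in> C" for t
      using X(3) \<open>x \<in> X\<close> that by (auto simp: dist_real_def)
    have "(SUP t\<in>C. F (x, t)) \<le> (SUP t\<in>C. F (x0, t)) + e / 2"
    proof (rule cSUP_least[OF C(2)])
      fix t assume t: "t \<in> C"
      show "F (x, t) \<le> (SUP t\<in>C. F (x0, t)) + e / 2"
        using d[OF t] cSUP_upper[OF t bdd[of x0]] by linarith
    qed
    moreover have "(SUP t\<in>C. F (x0, t)) \<le> (SUP t\<in>C. F (x, t)) + e / 2"
    proof (rule cSUP_least[OF C(2)])
      fix t assume t: "t \<in> C"
      show "F (x0, t) \<le> (SUP t\<in>C. F (x, t)) + e / 2"
        using d[OF t] cSUP_upper[OF t bdd[of x]] by linarith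
    qed
    ultimately show ?thesis using e by (simp add: dist_real_def)
  qed
  then show "\<forall>\<^sub>F x in at x0 within UNIV. dist (SUP t\<in>C. F (x, t)) (SUP t\<in>C. F (x0, t)) < e"
    using X(1,2) by (auto simp: eventually_at_topological)
qed

lemma compact_set_sums:
  fixes A B :: "'g::topological_group_add set"
  assumes "compact A" "compact B"
  shows "compact {a + b | a b. a \<in> A \<and> b \<in> B}"
proof -
  have "{a + b | a b. a \<in> A \<and> b \<in> B} = (\<lambda>z. fst z + snd z) ` (A \<times> B)" by force
  then show ?thesis
    using assms by (auto intro!: compact_continuous_image compact_Times continuous_intros)
qed

lemma ennreal_quarters: "e > 0 \<Longrightarrow> 2 * ennreal (e / 4) + 2 * ennreal (e / 4) = ennreal e"
  by (simp flip: ennreal_numeral ennreal_mult ennreal_plus)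

context haar_group
begin

lemma compact_neighbourhood:
  fixes K :: "'g set"
  assumes "compact K" obtains V L where "open V" "compact L" "K \<subseteq> V" "V \<subseteq> L"
proof -
  have "\<exists>U L. open U \<and> compact L \<and> x \<in> U \<and> U \<subseteq> L" for x :: 'g
    using lc unfolding locally_compact_group_def locally_compact_space_def by simp
  then obtain U L where UL: "\<And>x::'g. open (U x)" "\<And>x. compact (L x)" "\<And>x. x \<in> U x" "\<And>x. U x \<subseteq> L x"
    by metis
  obtain D where D: "D \<subseteq> K" "finite D" "K \<subseteq> (\<Union>x\<in>D. U x)"
  proof (rule compactE_image[OF assms, of K U])
    show "K \<subseteq> (\<Union>x\<in>K. U x)" using UL(3) by blast
  qed (use UL(1) in auto)
  show thesis
  proof
    show "open (\<Union>x\<in>D. U x)" using UL by blast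
    show "compact (\<Union>x\<in>D. L x)" using UL D by (intro compact_UN) auto
    show "(\<Union>x\<in>D. U x) \<subseteq> (\<Union>x\<in>D. L x)" using UL by blast
  qed fact
qed

lemma Urysohn_Cc:
  fixes K :: "'g set"
  assumes "compact K" "open U" "K \<subseteq> U"
  obtains g where "Cc g" "\<And>x. 0 \<le> g x" "\<And>x. g x \<le> 1" "\<And>x. x \<in> K \<Longrightarrow> g x = 1" "\<And>x. x \<notin> U \<Longrightarrow> g x = 0"
proof -
  obtain V L where VL: "open V" "compact L" "K \<subseteq> V" "V \<subseteq> L" using compact_neighbourhood[OF assms(1)] .
  \<comment> \<open>Requiring zeros off \<open>U \<inter> V\<close>, not just off \<open>U\<close>,
    confines the support to the compact set \<open>L\<close>.\<close>
  obtain g where g: "continuous_map euclidean (subtopology euclidean {0..1::real}) g"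
      "g ` (- (U \<inter> V)) \<subseteq> {0}" "g ` K \<subseteq> {1}"
    using Urysohn_completely_regular_compact_closed[OF _ completely_regular, of 0 1 K "- (U \<inter> V)"] assms VL
    by (auto simp: disjnt_def closed_Compl open_Int)
  have r: "continuous_on UNIV g" "\<And>x. g x \<in> {0..1}"
    using g(1) by (auto simp: continuous_map_in_subtopology)
  have z: "g x = 0" if "x \<notin> U \<inter> V" for x using g(2) that by blast
  show thesis
  proof
    show "Cc g" using r(1) VL(2)
    proof (rule CcI)
      show "x \<in> L" if "g x \<noteq> 0" for x using z[of x] that VL(4) by blast
    qed
    show "0 \<le> g x" "g x \<le> 1" for x using r(2)[of x] by auto
    show "g x = 1" if "x \<in> K" for x using g(3) that by blast
    show "g x = 0" if "x \<notin> U" for x using z that by blast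
  qed
qed

lemma bump: "\<exists>g. Cc g \<and> (\<forall>x. 0 \<le> g x) \<and> (\<forall>x. g x \<le> 1) \<and> g (0::'g) = 1"
proof (rule Urysohn_Cc[of "{0::'g}" UNIV])
  fix g assume "Cc g" "\<And>x. 0 \<le> g x" "\<And>x. g x \<le> 1" "\<And>x::'g. x \<in> {0} \<Longrightarrow> g x = (1::real)"
  then show ?thesis by (intro exI[of _ g]) simp
qed auto

text \<open>A supremum over the coset \<open>v + H\<close> makes a bump function right invariant
  with no measure on \<open>H\<close>; compactness of \<open>H\<close> keeps it continuous and
  compactly supported.\<close>

lemma invariant_bump:
  fixes H :: "'g set"
  assumes H: "compact_subgroup H"
  obtains \<psi> where "Cc \<psi>" "\<And>x. \<psi> x \<ge> 0" "\<psi> 0 > 0" "\<And>v h. h \<in> H \<Longrightarrow> \<psi> (v + h) = \<psi> v"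
proof -
  have H': "0 \<in> H" "compact H" "\<And>x y. x \<in> H \<Longrightarrow> y \<in> H \<Longrightarrow> x + y \<in> H" "\<And>x. x \<in> H \<Longrightarrow> - x \<in> H"
    using H by (auto simp: compact_subgroup_def)
  obtain g where g: "Cc g" "\<And>x. 0 \<le> g x" "\<And>x. g x \<le> 1" "g (0::'g) = 1"
    using bump by auto
  obtain K where K: "compact K" "\<And>x. g x \<noteq> 0 \<Longrightarrow> x \<in> K" using Cc_supportE[OF g(1)] by blast
  define \<psi> where "\<psi> v = (SUP h\<in>H. g (v + h))" for v
  have bdd: "bdd_above ((\<lambda>h. g (v + h)) ` H)" for v
    using g(3) by (intro bdd_aboveI[of _ 1]) auto
  have up: "g (v + h) \<le> \<psi> v" if "h \<in> H" for v h
    unfolding \<psi>_def using that by (rule cSUP_upper[OF _ bdd])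
  have cont: "continuous_on UNIV \<psi>"
    unfolding \<psi>_def
    using continuous_on_SUP_param[of "\<lambda>z. g (fst z + snd z)" H] H'(1,2)
    by (force intro!: Cc_continuous_compose[OF g(1)] continuous_intros)
  show thesis
  proof
    have "compact (uminus ` H)" using H'(2) by (intro compact_continuous_image continuous_intros)
    then have "compact {a + b | a b. a \<in> K \<and> b \<in> uminus ` H}" using K(1) compact_set_sums by blast
    with cont show "Cc \<psi>"
    proof (rule CcI)
      fix v assume "\<psi> v \<noteq> 0"
      \<comment> \<open>Otherwise the supremum would be that of the constant 0 over the nonempty set
        \<open>H\<close>.\<close>
      then obtain h where h: "h \<in> H" "g (v + h) \<noteq> 0"
        unfolding \<psi>_def using H'(1) by (metis (mono_tags, lifting) SUP_cong cSUP_const equals0D)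
      then have "v + h \<in> K" by (intro K(2))
      then show "v \<in> {a + b | a b. a \<in> K \<and> b \<in> uminus ` H}"
        using h by (intro CollectI exI[of _ "v + h"] exI[of _ "- h"]) (auto simp: add.assoc)
    qed
    show "\<psi> v \<ge> 0" for v using up[OF H'(1), of v] g(2)[of v] by simp
    show "\<psi> 0 > 0" using up[OF H'(1), of 0] g(4) by simp
    fix v h assume h: "h \<in> H"
    have "(+) h ` H = H"
    proof (intro equalityI subsetI)
      fix x assume "x \<in> H"
      then have "- h + x \<in> H" using h H' by blast
      then show "x \<in> (+) h ` H" by (rule rev_image_eqI) (simp add: add.assoc[symmetric])
    qed (use h H' in auto)
    moreover have "(\<lambda>k. g (v + k)) ` ((+) h ` H) = (\<lambda>k. g (v + h + k)) ` H"
      by (simp add: image_image add.assoc)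
    ultimately show "\<psi> (v + h) = \<psi> v" by (simp add: \<psi>_def)
  qed
qed

lemma Cc_integral_pos:
  assumes "Cc \<psi>" "\<And>x. \<psi> x \<ge> 0" "\<psi> a > 0"
  shows "(\<integral>x. \<psi> x \<partial>\<mu>) > 0"
proof (rule ccontr)
  assume "\<not> (\<integral>x. \<psi> x \<partial>\<mu>) > 0"
  moreover have "(\<integral>x. \<psi> x \<partial>\<mu>) \<ge> 0" using assms(2) by simp
  ultimately have "(\<integral>x. \<psi> x \<partial>\<mu>) = 0" by linarith
  then have ae: "AE x in \<mu>. \<psi> x = 0"
    using integral_nonneg_eq_0_iff_AE[OF Cc_integrable[OF assms(1)]] assms(2) by simp
  have op: "open {x. \<psi> x \<noteq> 0}"
    using Cc_continuous[OF assms(1)] by (intro open_Collect_neq continuous_intros) auto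
  then have "emeasure \<mu> {x. \<psi> x \<noteq> 0} = 0"
    using ae AE_iff_measurable[of "{x. \<psi> x \<noteq> 0}" \<mu> "\<lambda>x. \<psi> x = 0"] by simp
  moreover have "a \<in> {x. \<psi> x \<noteq> 0}" using assms(3) by simp
  ultimately show False using emeasure_open_pos[OF op] by (metis empty_iff less_irrefl)
qed

text \<open>Needed so that a weight times a compactly supported continuous function stays in that
  class. If \<open>l\<close> is at most \<open>B\<close> on the support of \<psi>, subadditivity
  keeps the average of \<open>l (u + g)\<close> against \<psi> within \<open>B\<close> of
  \<open>l g\<close>; adding \<open>B\<close> gives a majorant with error at most
  \<open>2 * B\<close>.\<close>

lemma continuous_majorant:
  fixes l :: "'g \<Rightarrow> real"
  assumes l: "l \<in> borel_measurable borel" "\<And>g. l g \<ge> 0" "\<And>g. l (- g) = l g" "\<And>g h. l (g + h) \<le> l g + l h"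
    and bdd: "\<And>K. compact K \<Longrightarrow> \<exists>B. \<forall>x\<in>K. l x \<le> B"
  obtains m M where "continuous_on UNIV m" "\<And>x. l x \<le> m x" "\<And>x. m x \<le> l x + M" "M \<ge> 0"
proof -
  obtain \<psi> where \<psi>: "Cc \<psi>" "\<And>x. 0 \<le> \<psi> x" "\<And>x. \<psi> x \<le> 1" "\<psi> (0::'g) = 1"
    using bump by auto
  obtain K where K: "compact K" "\<And>x. \<psi> x \<noteq> 0 \<Longrightarrow> x \<in> K" using Cc_supportE[OF \<psi>(1)] by blast
  obtain B0 where B0: "\<And>x. x \<in> K \<Longrightarrow> l x \<le> B0" using bdd[OF K(1)] by blast
  define B where "B = max B0 0"
  have B: "\<psi> u \<noteq> 0 \<Longrightarrow> l u \<le> B" "B \<ge> 0" for u using B0 K(2) by (auto simp: B_def le_max_iff_disj)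
  define I where "I = (\<integral>x. \<psi> x \<partial>\<mu>)"
  have I: "I > 0" unfolding I_def using \<psi> by (intro Cc_integral_pos[where a=0]) auto
  have i\<psi>: "integrable \<mu> (\<lambda>u. \<psi> u * c)" for c using Cc_integrable[OF \<psi>(1)] by simp
  obtain S where S: "\<And>x. \<bar>\<psi> x\<bar> \<le> S" "S \<ge> 0" using Cc_bounded[OF \<psi>(1)] by blast
  have ml: "(\<lambda>u. l (u + g)) \<in> borel_measurable borel" for g
    by (intro measurable_compose[OF _ l(1)] borel_measurable_continuous_onI continuous_intros)
  have near: "l (u + g) \<le> l g + B" "l g - B \<le> l (u + g)" if "\<psi> u \<noteq> 0" for u g
  proof -
    show "l (u + g) \<le> l g + B" using l(4)[of u g] B(1)[OF that] by simp
    have "l g = l (- u + (u + g))" by (simp add: add.assoc[symmetric])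
    then show "l g - B \<le> l (u + g)" using l(4)[of "- u" "u + g"] l(3)[of u] B(1)[OF that] by simp
  qed
  have il: "integrable \<mu> (\<lambda>u. \<psi> u * l (u + g))" for g
  proof (rule integrable_bounded_compact[OF _ K(1)])
    show "(\<lambda>u. \<psi> u * l (u + g)) \<in> borel_measurable borel" using ml Cc_borel[OF \<psi>(1)] by simp
    show "u \<in> K" if "\<psi> u * l (u + g) \<noteq> 0" for u using that K(2) by auto
    show "\<bar>\<psi> u * l (u + g)\<bar> \<le> S * (l g + B)" for u
    proof (cases "\<psi> u = 0")
      case True then show ?thesis using S(2) l(2)[of g] B(2) by simp
    next
      case False
      then show ?thesis
        unfolding abs_mult using S near(1)[OF False, of g] l(2) by (intro mult_mono) auto
    qed
  qed
  define j where "j g = (\<integral>u. \<psi> u * l (u + g) \<partial>\<mu>)" for g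
  have j1: "j g \<le> I * (l g + B)" for g
  proof -
    have "j g \<le> (\<integral>u. \<psi> u * (l g + B) \<partial>\<mu>)"
      unfolding j_def
    proof (rule integral_mono[OF il i\<psi>])
      fix u show "\<psi> u * l (u + g) \<le> \<psi> u * (l g + B)"
        using near(1)[of u g] \<psi>(2)[of u] by (cases "\<psi> u = 0") (auto intro!: mult_left_mono)
    qed
    then show ?thesis by (simp add: I_def)
  qed
  have j2: "I * (l g - B) \<le> j g" for g
  proof -
    have "(\<integral>u. \<psi> u * (l g - B) \<partial>\<mu>) \<le> j g"
      unfolding j_def
    proof (rule integral_mono[OF i\<psi> il])
      fix u show "\<psi> u * (l g - B) \<le> \<psi> u * l (u + g)"
        using near(2)[of u g] \<psi>(2)[of u] by (cases "\<psi> u = 0") (auto intro!: mult_left_mono)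
    qed
    then show ?thesis by (simp add: I_def)
  qed
  have cj: "continuous_on UNIV j"
    unfolding continuous_on_eq_continuous_at[OF open_UNIV]
  proof
    fix x0 :: 'g
    obtain V L where VL: "open V" "compact L" "{x0} \<subseteq> V" "V \<subseteq> L" by (rule compact_neighbourhood[of "{x0}"]) auto
    define C where "C = {a + b | a b. a \<in> K \<and> b \<in> L}"
    have C: "compact C" unfolding C_def using K(1) VL(2) by (rule compact_set_sums)
    obtain D where D: "\<And>x. x \<in> C \<Longrightarrow> l x \<le> D" using bdd[OF C] by blast
    \<comment> \<open>After translation the parameter sits in the continuous factor \<psi>, and
      \<open>l\<close> no longer depends on it. For parameters near \<open>x0\<close> the integrand
      lives on \<open>C\<close>, so \<open>l\<close> may be truncated there to become
      integrable.\<close>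
    have "continuous_on UNIV (\<lambda>g. \<integral>u. (\<lambda>z. \<psi> (snd z - fst z)) (g, u) * (l u * indicator C u) \<partial>\<mu>)"
    proof (rule continuous_integral_param[OF _ C])
      show "continuous_on UNIV (\<lambda>z. \<psi> (snd z - fst z))"
        by (intro Cc_continuous_compose[OF \<psi>(1)] continuous_intros)
      show "integrable \<mu> (\<lambda>u. l u * indicator C u)"
      proof (rule integrable_bounded_compact[OF _ C])
        show "(\<lambda>u. l u * indicator C u) \<in> borel_measurable borel"
          using l(1) borel_compact[OF C] by simp
        show "\<bar>l u * indicator C u\<bar> \<le> max 0 D" for u
          using D[of u] l(2)[of u] by (auto simp: indicator_def)
        show "u \<in> C" if "l u * indicator C u \<noteq> 0" for u
          using that by (auto simp: indicator_def split: if_splits)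
      qed
      show "u \<in> C" if "l u * indicator C u \<noteq> 0" for u
          using that by (auto simp: indicator_def split: if_splits)
    qed
    then have "continuous_on V (\<lambda>g. \<integral>u. \<psi> (u - g) * (l u * indicator C u) \<partial>\<mu>)"
      unfolding fst_conv snd_conv by (rule continuous_on_subset[OF _ subset_UNIV])
    moreover have "(\<integral>u. \<psi> (u - g) * (l u * indicator C u) \<partial>\<mu>) = j g" if "g \<in> V" for g
    proof -
      have "(\<integral>u. \<psi> (u - g) * (l u * indicator C u) \<partial>\<mu>) = (\<integral>u. \<psi> (u - g) * l u \<partial>\<mu>)"
      proof (intro Bochner_Integration.integral_cong refl)
        fix u
        have "u \<in> C" if "\<psi> (u - g) \<noteq> 0"
          unfolding C_def using K(2)[OF that] \<open>g \<in> V\<close> VL(4)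
          by (intro CollectI exI[of _ "u - g"] exI[of _ g]) auto
        then show "\<psi> (u - g) * (l u * indicator C u) = \<psi> (u - g) * l u"
          by (cases "\<psi> (u - g) = 0") auto
      qed
      also have "\<dots> = (\<integral>u. \<psi> (u + g - g) * l (u + g) \<partial>\<mu>)"
      proof (rule integral_translate[symmetric, where f="\<lambda>u. \<psi> (u - g) * l u"])
        have "(\<lambda>u. \<psi> (u - g)) \<in> borel_measurable borel"
          using Cc_borel[OF Cc_translate(1)[OF \<psi>(1), of "- g"]] by simp
        then show "(\<lambda>u. \<psi> (u - g) * l u) \<in> borel_measurable borel" using l(1) by simp
      qed
      finally show ?thesis by (simp add: j_def)
    qed
    ultimately have "continuous_on V j" by (simp cong: continuous_on_cong)
    then show "isCont j x0" using VL(1,3) continuous_on_eq_continuous_at by blast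
  qed
  show thesis
  proof
    show "continuous_on UNIV (\<lambda>x. j x / I + B)"
      using I by (intro continuous_intros cj) auto
    show "l x \<le> j x / I + B" "j x / I + B \<le> l x + 2 * B" for x
      using j1[of x] j2[of x] I by (auto simp: field_simps)
    show "2 * B \<ge> 0" using B(2) by simp
  qed
qed

section \<open>Density of compactly supported continuous functions in L2\<close>

definition N2 :: "('g \<Rightarrow> real) \<Rightarrow> ennreal" where
  "N2 f = (\<integral>\<^sup>+x. ennreal ((f x)\<^sup>2) \<partial>\<mu>)"

lemma N2_mono: "(\<And>x. \<bar>f x\<bar> \<le> \<bar>g x\<bar>) \<Longrightarrow> N2 f \<le> N2 g"
  unfolding N2_def by (intro nn_integral_mono ennreal_leI) (simp add: abs_le_square_iff)

text \<open>Stands in for the triangle inequality, so that squared norms suffice throughout; the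
  factor 2 is harmless because (RD) allows any constant.\<close>

lemma N2_add:
  assumes [measurable]: "f \<in> borel_measurable borel" "g \<in> borel_measurable borel"
  shows "N2 (\<lambda>x. f x + g x) \<le> 2 * N2 f + 2 * N2 g"
proof -
  have "N2 (\<lambda>x. f x + g x) \<le> (\<integral>\<^sup>+x. 2 * ennreal ((f x)\<^sup>2) + 2 * ennreal ((g x)\<^sup>2) \<partial>\<mu>)"
    unfolding N2_def
  proof (rule nn_integral_mono)
    fix x
    have "(f x + g x)\<^sup>2 \<le> 2 * (f x)\<^sup>2 + 2 * (g x)\<^sup>2"
      using zero_le_power2[of "f x - g x"] by (simp add: power2_eq_square algebra_simps)
    then have "ennreal ((f x + g x)\<^sup>2) \<le> ennreal (2 * (f x)\<^sup>2 + 2 * (g x)\<^sup>2)" by (rule ennreal_leI)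
    then show "ennreal ((f x + g x)\<^sup>2) \<le> 2 * ennreal ((f x)\<^sup>2) + 2 * ennreal ((g x)\<^sup>2)"
      by (simp add: ennreal_mult)
  qed
  also have "\<dots> = 2 * N2 f + 2 * N2 g"
    unfolding N2_def by (simp add: nn_integral_add nn_integral_cmult)
  finally show ?thesis .
qed

lemma N2_cmult: "f \<in> borel_measurable borel \<Longrightarrow> N2 (\<lambda>x. c * f x) = ennreal (c\<^sup>2) * N2 f"
  unfolding N2_def by (simp add: power_mult_distrib ennreal_mult nn_integral_cmult)

lemma N2_Cc: "Cc f \<Longrightarrow> N2 f = ennreal (\<integral>x. (f x)\<^sup>2 \<partial>\<mu>)"
  unfolding N2_def by (intro nn_integral_eq_integral Cc_integrable Cc_power2) auto

definition Cc_approx :: "('g \<Rightarrow> real) \<Rightarrow> bool" where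
  "Cc_approx \<xi> \<longleftrightarrow> \<xi> \<in> borel_measurable borel \<and> (\<forall>e>0. \<exists>g. Cc g \<and> N2 (\<lambda>x. \<xi> x - g x) \<le> ennreal e)"

text \<open>Inner regularity is available for open sets only. Hence \<open>K\<close> is chosen
  inside the open set \<open>U\<close> around \<open>E\<close>, not inside \<open>E\<close>; a
  Urysohn function between \<open>K\<close> and \<open>U\<close> differs from the indicator of
  \<open>E\<close> only on \<open>U - E\<close> and \<open>U - K\<close>, both small.\<close>

lemma Cc_approx_indicator:
  assumes E: "E \<in> sets borel" "emeasure \<mu> E < \<infinity>"
  shows "Cc_approx (indicator E)"
  unfolding Cc_approx_def
proof (intro conjI allI impI)
  fix e :: real assume e: "e > 0"
  obtain U where U: "open U" "E \<subseteq> U" "emeasure \<mu> U < emeasure \<mu> E + ennreal (e / 2)"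
    using INF_approx_ennreal[OF _ emeasure_outer_regular[OF E(1)], of "e / 2"] e E(2) by (auto simp: less_top)
  have Ufin: "emeasure \<mu> U < \<infinity>" using U(3) E(2) by (metis ennreal_add_eq_top ennreal_less_top infinity_ennreal_def less_top order_less_trans top.not_eq_extremum)
  obtain K where K: "compact K" "K \<subseteq> U" "emeasure \<mu> U < emeasure \<mu> K + ennreal (e / 2)"
  proof -
    have "{} \<in> {K. compact K \<and> K \<subseteq> U}" by simp
    then have "\<exists>K\<in>{K. compact K \<and> K \<subseteq> U}. emeasure \<mu> U < emeasure \<mu> K + ennreal (e / 2)"
      using e Ufin by (intro SUP_approx_ennreal emeasure_inner_regular U(1)) auto
    then show thesis using that by blast
  qed
  obtain g where g: "Cc g" "\<And>x. 0 \<le> g x" "\<And>x. g x \<le> 1" "\<And>x. x \<in> K \<Longrightarrow> g x = 1" "\<And>x. x \<notin> U \<Longrightarrow> g x = 0"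
    using Urysohn_Cc[OF K(1) U(1) K(2)] by metis
  have Km: "K \<in> sets borel" and Um: "U \<in> sets borel" using K U borel_compact by auto
  have diff: "emeasure \<mu> (U - A) \<le> ennreal (e / 2)"
    if A: "A \<in> sets borel" "A \<subseteq> U" "emeasure \<mu> U < emeasure \<mu> A + ennreal (e / 2)" for A
  proof -
    have "emeasure \<mu> A + emeasure \<mu> (U - A) = emeasure \<mu> U"
      using A Um by (subst plus_emeasure) (auto simp: Un_absorb1)
    then have "emeasure \<mu> A + emeasure \<mu> (U - A) \<le> emeasure \<mu> A + ennreal (e / 2)" using A(3) by simp
    moreover have "emeasure \<mu> A \<noteq> top"
      using emeasure_mono[OF A(2), of \<mu>] Um Ufin by (auto simp: top_unique)
    ultimately show ?thesis by (simp add: ennreal_add_left_cancel_le)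
  qed
  have "N2 (\<lambda>x. indicator E x - g x) \<le> (\<integral>\<^sup>+x. indicator (U - E) x + indicator (U - K) x \<partial>\<mu>)"
    unfolding N2_def
  proof (rule nn_integral_mono)
    fix x
    have le1: "ennreal ((indicator E x - g x)\<^sup>2) \<le> 1"
      using g(2)[of x] g(3)[of x] by (auto simp: indicator_def abs_square_le_1 ennreal_le_1)
    consider "x \<notin> U" | "x \<in> K" "x \<in> E" | "x \<in> U" "x \<notin> K" | "x \<in> U" "x \<notin> E" using K(2) by blast
    then show "ennreal ((indicator E x - g x)\<^sup>2) \<le> indicator (U - E) x + indicator (U - K) x"
    proof cases
      case 1 then show ?thesis using g(5) U(2) by (auto simp: indicator_def)
    next
      case 2 then show ?thesis using g(4) by simp
    next
      case 3 then show ?thesis by (intro order_trans[OF le1]) (simp add: add_increasing)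
    next
      case 4 then show ?thesis by (intro order_trans[OF le1]) (simp add: add_increasing2)
    qed
  qed
  also have "\<dots> = emeasure \<mu> (U - E) + emeasure \<mu> (U - K)"
    using Km Um E(1) by (subst nn_integral_add) auto
  also have "\<dots> \<le> ennreal (e / 2) + ennreal (e / 2)"
    using diff[OF E(1) U(2,3)] diff[OF Km K(2,3)] by (rule add_mono)
  also have "\<dots> = ennreal e" using e by (simp flip: ennreal_plus)
  finally show "\<exists>g. Cc g \<and> N2 (\<lambda>x. indicator E x - g x) \<le> ennreal e" using g(1) by blast
qed (use E in simp)

lemma Cc_approx_zero: "Cc_approx (\<lambda>_. 0)"
proof -
  have "Cc (\<lambda>_::'g. 0)" by (rule CcI[of _ "{}"]) auto
  then show ?thesis unfolding Cc_approx_def N2_def by (auto intro!: exI[of _ "\<lambda>_. 0"])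
qed

lemma Cc_approx_add:
  assumes "Cc_approx f" "Cc_approx g" shows "Cc_approx (\<lambda>x. f x + g x)"
  unfolding Cc_approx_def
proof (intro conjI allI impI)
  have m: "f \<in> borel_measurable borel" "g \<in> borel_measurable borel" using assms by (auto simp: Cc_approx_def)
  then show "(\<lambda>x. f x + g x) \<in> borel_measurable borel" by simp
  fix e :: real assume e: "e > 0"
  obtain f' where f': "Cc f'" "N2 (\<lambda>x. f x - f' x) \<le> ennreal (e / 4)"
    using assms(1) e unfolding Cc_approx_def by (meson divide_pos_pos zero_less_numeral)
  obtain g' where g': "Cc g'" "N2 (\<lambda>x. g x - g' x) \<le> ennreal (e / 4)"
    using assms(2) e unfolding Cc_approx_def by (meson divide_pos_pos zero_less_numeral)
  have "N2 (\<lambda>x. f x + g x - (f' x + g' x)) = N2 (\<lambda>x. (f x - f' x) + (g x - g' x))"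
    by (simp add: algebra_simps)
  also have "\<dots> \<le> 2 * N2 (\<lambda>x. f x - f' x) + 2 * N2 (\<lambda>x. g x - g' x)"
    using m Cc_borel[OF f'(1)] Cc_borel[OF g'(1)] by (intro N2_add) auto
  also have "\<dots> \<le> 2 * ennreal (e / 4) + 2 * ennreal (e / 4)"
    using f' g' by (intro add_mono mult_left_mono) auto
  also have "\<dots> = ennreal e" using e by (rule ennreal_quarters)
  finally show "\<exists>h. Cc h \<and> N2 (\<lambda>x. f x + g x - h x) \<le> ennreal e"
    using Cc_add[OF f'(1) g'(1)] by (intro exI[of _ "\<lambda>x. f' x + g' x"]) simp
qed

lemma Cc_approx_cmult:
  assumes "Cc_approx f" shows "Cc_approx (\<lambda>x. c * f x)"
  unfolding Cc_approx_def
proof (intro conjI allI impI)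
  have m: "f \<in> borel_measurable borel" using assms by (auto simp: Cc_approx_def)
  then show "(\<lambda>x. c * f x) \<in> borel_measurable borel" by simp
  fix e :: real assume e: "e > 0"
  have "e / (c\<^sup>2 + 1) > 0" using e by (simp add: add_nonneg_pos)
  then obtain f' where f': "Cc f'" "N2 (\<lambda>x. f x - f' x) \<le> ennreal (e / (c\<^sup>2 + 1))"
    using assms unfolding Cc_approx_def by blast
  have "N2 (\<lambda>x. c * f x - c * f' x) = ennreal (c\<^sup>2) * N2 (\<lambda>x. f x - f' x)"
    using m Cc_borel[OF f'(1)] N2_cmult[of "\<lambda>x. f x - f' x" c] by (simp add: algebra_simps)
  also have "\<dots> \<le> ennreal (c\<^sup>2) * ennreal (e / (c\<^sup>2 + 1))" using f'(2) by (rule mult_left_mono) simp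
  also have "\<dots> = ennreal (c\<^sup>2 * (e / (c\<^sup>2 + 1)))" using e by (intro ennreal_mult[symmetric]) auto
  also have "\<dots> \<le> ennreal e"
  proof (rule ennreal_leI)
    have "c\<^sup>2 + 1 > 0" by (simp add: add_nonneg_pos)
    then show "c\<^sup>2 * (e / (c\<^sup>2 + 1)) \<le> e" using e by (simp add: divide_le_eq algebra_simps)
  qed
  finally show "\<exists>h. Cc h \<and> N2 (\<lambda>x. c * f x - h x) \<le> ennreal e"
    using Cc_cmult[OF f'(1)] by (intro exI[of _ "\<lambda>x. c * f' x"]) simp
qed

lemma Cc_approx_simple:
  assumes s: "simple_function \<mu> s" "N2 s < \<infinity>"
  shows "Cc_approx s"
proof -
  have fin: "finite (range s)" using simple_functionD(1)[OF s(1)] by simp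
  have lev: "s -` {y} \<in> sets borel" for y using simple_functionD(2)[OF s(1), of "{y}"] by simp
  have "Cc_approx (\<lambda>x. \<Sum>y\<in>S. y * indicator (s -` {y}) x)" if "finite S" for S :: "real set"
    using that
  proof (induction S rule: finite_induct)
    case empty then show ?case by (simp add: Cc_approx_zero)
  next
    case (insert y S)
    \<comment> \<open>The level set of 0 may have infinite measure, but its term vanishes; every
      other level set has finite measure because \<open>N2 s\<close> is finite.\<close>
    have "Cc_approx (\<lambda>x. y * indicator (s -` {y}) x)"
    proof (cases "y = 0")
      case True then show ?thesis by (simp add: Cc_approx_zero)
    next
      case False
      have "ennreal (y\<^sup>2) * emeasure \<mu> (s -` {y}) = (\<integral>\<^sup>+x. ennreal (y\<^sup>2) * indicator (s -` {y}) x \<partial>\<mu>)"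
        using lev by (simp add: nn_integral_cmult_indicator)
      also have "\<dots> \<le> N2 s" unfolding N2_def by (intro nn_integral_mono) (auto simp: indicator_def)
      also have "\<dots> < \<infinity>" by (rule s(2))
      finally have "emeasure \<mu> (s -` {y}) < \<infinity>"
        using False by (auto simp: ennreal_mult_less_top)
      then show ?thesis by (intro Cc_approx_cmult Cc_approx_indicator lev)
    qed
    from Cc_approx_add[OF this insert.IH] show ?case
      by (simp only: sum.insert[OF insert.hyps])
  qed
  from this[OF fin] have "Cc_approx (\<lambda>x. \<Sum>y\<in>range s. y * indicator (s -` {y}) x)" .
  also have "(\<lambda>x. \<Sum>y\<in>range s. y * indicator (s -` {y}) x) = s"
  proof
    fix x
    have "(\<Sum>y\<in>range s. y * indicator (s -` {y}) x) = (\<Sum>y\<in>range s. if y = s x then y else 0)"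
      by (intro sum.cong) (auto simp: indicator_def)
    then show "(\<Sum>y\<in>range s. y * indicator (s -` {y}) x) = s x" using fin by simp
  qed
  finally show ?thesis .
qed

lemma Cc_approx_L2:
  assumes \<xi>: "\<xi> \<in> borel_measurable borel" "N2 \<xi> < \<infinity>"
  shows "Cc_approx \<xi>"
  unfolding Cc_approx_def
proof (intro conjI allI impI)
  fix e :: real assume e: "e > 0"
  have \<xi>': "\<xi> \<in> borel_measurable \<mu>" using \<xi>(1) by simp
  obtain s where s: "\<And>i. simple_function \<mu> (s i)" "\<And>x. (\<lambda>i. s i x) \<longlonglongrightarrow> \<xi> x"
    "\<And>i x. \<bar>s i x\<bar> \<le> 2 * \<bar>\<xi> x\<bar>"
    using borel_measurable_implies_sequence_metric[OF \<xi>', of 0] by (auto simp: dist_real_def)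
  have sm [measurable]: "s i \<in> borel_measurable borel" for i
    using borel_measurable_simple_function[OF s(1), of i] by simp
  \<comment> \<open>The factor 3 is 1 + 2: the simple functions are bounded by
    \<open>2 * \<bar>\<xi> x\<bar>\<close>.\<close>
  have fin: "(\<integral>\<^sup>+x. ennreal ((3 * \<xi> x)\<^sup>2) \<partial>\<mu>) < \<infinity>"
    using N2_cmult[OF \<xi>(1), of 3] \<xi>(2) by (simp add: N2_def ennreal_mult_less_top)
  have bd: "\<bar>\<xi> x - s i x\<bar> \<le> \<bar>3 * \<xi> x\<bar>" for i x using s(3)[of i x] by auto
  have "(\<lambda>i. \<integral>\<^sup>+x. ennreal ((\<xi> x - s i x)\<^sup>2) \<partial>\<mu>) \<longlonglongrightarrow> (\<integral>\<^sup>+x. 0 \<partial>\<mu>)"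
  proof (rule nn_integral_dominated_convergence[OF _ _ _ _ fin])
    show "AE x in \<mu>. ennreal ((\<xi> x - s j x)\<^sup>2) \<le> ennreal ((3 * \<xi> x)\<^sup>2)" for j
      using bd[of _ j] by (intro AE_I2 ennreal_leI) (simp only: abs_le_square_iff)
    show "AE x in \<mu>. (\<lambda>i. ennreal ((\<xi> x - s i x)\<^sup>2)) \<longlonglongrightarrow> 0"
    proof (rule AE_I2)
      fix x
      have "(\<lambda>i. (\<xi> x - s i x)\<^sup>2) \<longlonglongrightarrow> (\<xi> x - \<xi> x)\<^sup>2" by (intro tendsto_intros s(2))
      then show "(\<lambda>i. ennreal ((\<xi> x - s i x)\<^sup>2)) \<longlonglongrightarrow> 0" using tendsto_ennrealI by fastforce
    qed
  qed (use \<xi>(1) in auto)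
  then have "(\<lambda>i. N2 (\<lambda>x. \<xi> x - s i x)) \<longlonglongrightarrow> 0" by (simp add: N2_def)
  then have "eventually (\<lambda>i. N2 (\<lambda>x. \<xi> x - s i x) < ennreal (e / 4)) sequentially"
    using e by (intro order_tendstoD(2)) auto
  then obtain i where i: "N2 (\<lambda>x. \<xi> x - s i x) < ennreal (e / 4)" by (auto simp: eventually_sequentially)
  have "N2 (s i) \<le> N2 (\<lambda>x. 2 * \<xi> x)" by (intro N2_mono) (simp add: abs_mult s(3))
  also have "\<dots> < \<infinity>" using N2_cmult[OF \<xi>(1), of 2] \<xi>(2) by (simp add: ennreal_mult_less_top)
  finally have "Cc_approx (s i)" by (intro Cc_approx_simple s(1))
  then obtain g where g: "Cc g" "N2 (\<lambda>x. s i x - g x) \<le> ennreal (e / 4)"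
    using e unfolding Cc_approx_def by (meson divide_pos_pos zero_less_numeral)
  have "N2 (\<lambda>x. \<xi> x - g x) = N2 (\<lambda>x. (\<xi> x - s i x) + (s i x - g x))" by simp
  also have "\<dots> \<le> 2 * N2 (\<lambda>x. \<xi> x - s i x) + 2 * N2 (\<lambda>x. s i x - g x)"
    using \<xi>(1) Cc_borel[OF g(1)] by (intro N2_add) auto
  also have "\<dots> \<le> 2 * ennreal (e / 4) + 2 * ennreal (e / 4)"
    using i g by (intro add_mono mult_left_mono) auto
  also have "\<dots> = ennreal e" using e by (rule ennreal_quarters)
  finally show "\<exists>g. Cc g \<and> N2 (\<lambda>x. \<xi> x - g x) \<le> ennreal e" using g(1) by auto
qed (fact \<xi>(1))

lemma L2_product_integrable:
  assumes [measurable]: "a \<in> borel_measurable borel" "b \<in> borel_measurable borel"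
    and fin: "N2 a < \<infinity>" "N2 b < \<infinity>"
  shows "integrable \<mu> (\<lambda>x. (a x)\<^sup>2)" "integrable \<mu> (\<lambda>x. a x * b x)"
proof -
  have sq: "integrable \<mu> (\<lambda>x. (a x)\<^sup>2)" "integrable \<mu> (\<lambda>x. (b x)\<^sup>2)"
    using fin by (auto simp: integrable_iff_bounded N2_def)
  show "integrable \<mu> (\<lambda>x. (a x)\<^sup>2)" by fact
  show "integrable \<mu> (\<lambda>x. a x * b x)"
  proof (rule Bochner_Integration.integrable_bound[OF Bochner_Integration.integrable_add[OF sq]])
    show "AE x in \<mu>. norm (a x * b x) \<le> norm ((a x)\<^sup>2 + (b x)\<^sup>2)"
    proof (rule AE_I2)
      fix x
      have "2 * (\<bar>a x\<bar> * \<bar>b x\<bar>) \<le> (a x)\<^sup>2 + (b x)\<^sup>2"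
        using zero_le_power2[of "\<bar>a x\<bar> - \<bar>b x\<bar>"] by (simp add: power2_eq_square algebra_simps)
      moreover have "0 \<le> \<bar>a x\<bar> * \<bar>b x\<bar>" by simp
      ultimately show "norm (a x * b x) \<le> norm ((a x)\<^sup>2 + (b x)\<^sup>2)"
        unfolding real_norm_def abs_mult by linarith
    qed
  qed simp
qed

text \<open>L2 approximation of \<xi> gives convergence of the convolutions at every point, and
  Fatou's lemma transfers the bound. The factor 2 comes from comparing the norms of the approximants
  with that of \<xi> through \<open>N2_add\<close>.\<close>

lemma conv_L2_bound_extend:
  assumes f: "Cc f" "\<And>x. f x \<ge> 0" and C: "C \<ge> 0"
    and bound: "\<And>g. Cc g \<Longrightarrow> (\<And>x. g x \<ge> 0) \<Longrightarrow> N2 (conv f g) \<le> ennreal C * N2 g"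
    and \<xi>: "\<xi> \<in> borel_measurable borel" "N2 \<xi> < \<infinity>" "\<And>x. \<xi> x \<ge> 0"
  shows "N2 (conv f \<xi>) \<le> ennreal (2 * C) * N2 \<xi>"
proof -
  have "\<exists>g. Cc g \<and> (\<forall>x. g x \<ge> 0) \<and> N2 (\<lambda>x. \<xi> x - g x) \<le> ennreal (1 / Suc n)" for n
  proof -
    obtain g where g: "Cc g" "N2 (\<lambda>x. \<xi> x - g x) \<le> ennreal (1 / Suc n)"
      using Cc_approx_L2[OF \<xi>(1,2)] unfolding Cc_approx_def by (meson of_nat_0_less_iff zero_less_Suc zero_less_divide_1_iff)
    \<comment> \<open>The assumed bound concerns nonnegative functions only; since \<xi> is
      nonnegative, passing to absolute values brings the approximant no further away.\<close>
    have "N2 (\<lambda>x. \<xi> x - \<bar>g x\<bar>) \<le> N2 (\<lambda>x. \<xi> x - g x)" 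
    proof (rule N2_mono)
      show "\<bar>\<xi> x - \<bar>g x\<bar>\<bar> \<le> \<bar>\<xi> x - g x\<bar>" for x using \<xi>(3)[of x] by linarith
    qed
    then show ?thesis using g Cc_abs[OF g(1)] by (intro exI[of _ "\<lambda>x. \<bar>g x\<bar>"]) auto
  qed
  then obtain g where g: "\<And>n. Cc (g n)" "\<And>n x. g n x \<ge> 0"
    "\<And>n. N2 (\<lambda>x. \<xi> x - g n x) \<le> ennreal (1 / Suc n)" by metis
  have gm [measurable]: "g n \<in> borel_measurable borel" for n using g(1) Cc_borel by blast
  have N2g: "N2 (g n) \<le> 2 * N2 \<xi> + ennreal (2 / Suc n)" for n
  proof -
    have "N2 (g n) = N2 (\<lambda>x. \<xi> x + (g n x - \<xi> x))" by simp
    also have "\<dots> \<le> 2 * N2 \<xi> + 2 * N2 (\<lambda>x. g n x - \<xi> x)"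
      using \<xi>(1) by (intro N2_add) auto
    also have "N2 (\<lambda>x. g n x - \<xi> x) = N2 (\<lambda>x. \<xi> x - g n x)" by (simp add: N2_def power2_commute)
    also have "2 * N2 \<xi> + 2 * N2 (\<lambda>x. \<xi> x - g n x) \<le> 2 * N2 \<xi> + 2 * ennreal (1 / Suc n)"
      using g(3) by (intro add_mono mult_left_mono) auto
    also have "2 * ennreal (1 / Suc n) = ennreal (2 * (1 / Suc n))" by (subst ennreal_mult) auto
    finally show ?thesis by simp
  qed
  have lim: "(\<lambda>n. conv f (g n) x) \<longlonglongrightarrow> conv f \<xi> x" for x
  proof -
    \<comment> \<open>For fixed \<open>x\<close> this reflected translate of \<open>f\<close> is an
      L2 function, so Cauchy-Schwarz turns L2 convergence of \<open>g n\<close> into convergence at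
      \<open>x\<close>.\<close>
    define a where "a = (\<lambda>y. f (x - y))"
    have a: "Cc a" unfolding a_def by (rule Cc_translate(2)[OF f(1)])
    have am: "a \<in> borel_measurable borel" "N2 a < \<infinity>" using a Cc_borel N2_Cc[OF a] by auto
    define A where "A = (\<integral>y. (a y)\<^sup>2 \<partial>\<mu>)"
    have "\<bar>conv f (g n) x - conv f \<xi> x\<bar> \<le> sqrt A * sqrt (1 / Suc n)" for n
    proof -
      define b where "b = (\<lambda>y. \<bar>\<xi> y - g n y\<bar>)"
      have bm: "b \<in> borel_measurable borel" using \<xi>(1) by (simp add: b_def)
      have Nb: "N2 b \<le> ennreal (1 / Suc n)" using g(3)[of n] by (simp add: N2_def b_def)
      then have bf: "N2 b < \<infinity>" by (rule order.strict_trans1) simp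
      have "\<bar>conv f (g n) x - conv f \<xi> x\<bar> = \<bar>\<integral>y. a y * (g n y - \<xi> y) \<partial>\<mu>\<bar>"
      proof -
        have i1: "integrable \<mu> (\<lambda>y. a y * g n y)"
          using L2_product_integrable(2)[OF am(1) gm am(2)] N2_Cc[OF g(1)] by simp
        have i2: "integrable \<mu> (\<lambda>y. a y * \<xi> y)"
          using L2_product_integrable(2)[OF am(1) \<xi>(1) am(2) \<xi>(2)] .
        show ?thesis using i1 i2 by (simp add: conv_def a_def right_diff_distrib)
      qed
      also have "\<dots> \<le> (\<integral>y. \<bar>a y * (g n y - \<xi> y)\<bar> \<partial>\<mu>)" by (rule integral_abs_bound)
      also have "\<dots> = (\<integral>y. 1 * (a y * b y) \<partial>\<mu>)"
        using f(2) by (intro Bochner_Integration.integral_cong refl) (simp add: abs_mult a_def b_def abs_minus_commute)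
      also have "\<dots> \<le> sqrt (\<integral>y. 1 * (a y)\<^sup>2 \<partial>\<mu>) * sqrt (\<integral>y. 1 * (b y)\<^sup>2 \<partial>\<mu>)"
        using L2_product_integrable[OF am(1) bm am(2) bf] L2_product_integrable(1)[OF bm am(1) bf am(2)]
        by (intro weighted_Cauchy_Schwarz) auto
      also have "\<dots> \<le> sqrt A * sqrt (1 / Suc n)"
      proof -
        have "ennreal (\<integral>y. (b y)\<^sup>2 \<partial>\<mu>) = N2 b"
          unfolding N2_def using L2_product_integrable(1)[OF bm am(1) bf am(2)]
          by (subst nn_integral_eq_integral) auto
        then have "ennreal (\<integral>y. (b y)\<^sup>2 \<partial>\<mu>) \<le> ennreal (1 / Suc n)" using Nb by simp
        then have "(\<integral>y. (b y)\<^sup>2 \<partial>\<mu>) \<le> 1 / Suc n" by (subst (asm) ennreal_le_iff) auto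
        then show ?thesis by (simp add: A_def mult_left_mono)
      qed
      finally show ?thesis .
    qed
    moreover have "(\<lambda>n. sqrt A * sqrt (1 / Suc n)) \<longlonglongrightarrow> 0"
    proof -
      have "(\<lambda>n. sqrt A * sqrt (1 / real (Suc n))) \<longlonglongrightarrow> sqrt A * sqrt 0"
        by (intro tendsto_intros LIMSEQ_inverse_real_of_nat[unfolded inverse_eq_divide])
      then show ?thesis by simp
    qed
    ultimately have "(\<lambda>n. conv f (g n) x - conv f \<xi> x) \<longlonglongrightarrow> 0"
      using Lim_null_comparison[OF always_eventually, of "\<lambda>n. conv f (g n) x - conv f \<xi> x"]
      unfolding real_norm_def by presburger
    then show ?thesis by (simp add: LIM_zero_iff)
  qed
  \<comment> \<open>Because the limit holds at every point, the integrand equals the liminf of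
    measurable functions.\<close>
  have "N2 (conv f \<xi>) = (\<integral>\<^sup>+x. liminf (\<lambda>n. ennreal ((conv f (g n) x)\<^sup>2)) \<partial>\<mu>)"
    unfolding N2_def
  proof (intro nn_integral_cong lim_imp_Liminf[symmetric] sequentially_bot)
    show "(\<lambda>n. ennreal ((conv f (g n) x)\<^sup>2)) \<longlonglongrightarrow> ennreal ((conv f \<xi> x)\<^sup>2)" for x
      by (intro tendsto_ennrealI tendsto_power lim)
  qed
  also have "\<dots> \<le> liminf (\<lambda>n. N2 (conv f (g n)))"
    unfolding N2_def using Cc_borel[OF Cc_conv[OF f(1) g(1)]] by (intro nn_integral_liminf) auto
  also have "\<dots> \<le> liminf (\<lambda>n. ennreal C * (2 * N2 \<xi> + ennreal (2 / Suc n)))"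
  proof (intro Liminf_mono always_eventually allI)
    fix n
    have "N2 (conv f (g n)) \<le> ennreal C * N2 (g n)" by (rule bound[OF g(1,2)])
    also have "\<dots> \<le> ennreal C * (2 * N2 \<xi> + ennreal (2 / Suc n))" by (intro mult_left_mono N2g) simp
    finally show "N2 (conv f (g n)) \<le> ennreal C * (2 * N2 \<xi> + ennreal (2 / Suc n))" .
  qed
  also have "\<dots> = ennreal C * (2 * N2 \<xi> + ennreal 0)"
  proof (intro lim_imp_Liminf sequentially_bot tendsto_const ennreal_tendsto_cmult tendsto_add tendsto_ennrealI)
    have "(\<lambda>n. 2 * (1 / real (Suc n))) \<longlonglongrightarrow> 2 * 0"
      by (intro tendsto_intros LIMSEQ_inverse_real_of_nat[unfolded inverse_eq_divide])
    then show "(\<lambda>n. 2 / real (Suc n)) \<longlonglongrightarrow> 0" by simp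
  qed simp
  also have "\<dots> = ennreal (2 * C) * N2 \<xi>" using C by (simp add: ennreal_mult mult_ac)
  finally show ?thesis .
qed

end

section \<open>The coset space of a compact subgroup\<close>

text \<open>Holds without measurability of \<open>g\<close>, because the integral is a supremum over simple functions
  below the integrand.\<close>

lemma nn_integral_distr_le:
  assumes T: "T \<in> measurable M N"
  shows "(\<integral>\<^sup>+y. g y \<partial>distr M N T) \<le> (\<integral>\<^sup>+x. g (T x) \<partial>M)"
  unfolding nn_integral_def[of "distr M N T"]
proof (rule SUP_least)
  fix s assume s: "s \<in> {s. simple_function (distr M N T) s \<and> s \<le> g}"
  then have sm: "simple_function (distr M N T) s" and le: "\<And>y. s y \<le> g y" by (auto simp: le_fun_def)
  have "s \<in> borel_measurable N" using borel_measurable_simple_function[OF sm] by simp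
  then have "integral\<^sup>S (distr M N T) s = (\<integral>\<^sup>+x. s (T x) \<partial>M)"
    using nn_integral_eq_simple_integral[OF sm] nn_integral_distr[OF T, of s] by simp
  also have "\<dots> \<le> (\<integral>\<^sup>+x. g (T x) \<partial>M)" using le by (intro nn_integral_mono)
  finally show "integral\<^sup>S (distr M N T) s \<le> (\<integral>\<^sup>+x. g (T x) \<partial>M)" .
qed

lemma rcoset_singleton_zero [simp]: "rcoset {0} x = {x}"
  by (simp add: rcoset_def)

lemma rep_singleton [simp]: "rep {x} = x"
  by (simp add: rep_def)

locale haar_pair = haar_group \<mu> for \<mu> :: "'g::{topological_group_add,t2_space} measure" +
  fixes H :: "'g set"
  assumes H: "compact_subgroup H"
begin

lemma H_zero [simp]: "0 \<in> H" and H_add: "x \<in> H \<Longrightarrow> y \<in> H \<Longrightarrow> x + y \<in> H"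
  and H_minus: "x \<in> H \<Longrightarrow> - x \<in> H" and H_compact: "compact H"
  using H by (auto simp: compact_subgroup_def)

lemma mem_rcoset: "x \<in> rcoset H x"
  unfolding rcoset_def by (rule rev_image_eqI[of 0]) auto

lemma rcoset_left: 
  assumes "h \<in> H" shows "rcoset H (h + x) = rcoset H x"
proof (intro equalityI subsetI)
  fix y assume "y \<in> rcoset H (h + x)"
  then obtain k where k: "k \<in> H" "y = k + (h + x)" by (auto simp: rcoset_def)
  then show "y \<in> rcoset H x" 
    unfolding rcoset_def by (intro rev_image_eqI[of "k + h"]) (auto simp: H_add assms add.assoc)
next
  fix y assume "y \<in> rcoset H x"
  then obtain k where k: "k \<in> H" "y = k + x" by (auto simp: rcoset_def)
  then show "y \<in> rcoset H (h + x)"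
    unfolding rcoset_def by (intro rev_image_eqI[of "k + - h"])
      (auto simp: H_add H_minus assms add.assoc diff_conv_add_uminus simp del: add_uminus_conv_diff)
qed

lemma rep_rcoset: obtains h where "h \<in> H" "rep (rcoset H x) = h + x"
proof -
  have "rep (rcoset H x) \<in> rcoset H x" unfolding rep_def using mem_rcoset by (rule someI)
  then show thesis using that by (auto simp: rcoset_def)
qed

lemma rcoset_eqD:
  assumes "rcoset H x = rcoset H y" obtains h where "h \<in> H" "x = h + y"
  using mem_rcoset[of x] assms that by (auto simp: rcoset_def)

lemma openin_coset: "openin (coset_topology H) U \<longleftrightarrow> U \<subseteq> cosets H \<and> open (rcoset H -` U)"
proof -
  have "istopology (\<lambda>U. U \<subseteq> cosets H \<and> open (rcoset H -` U))"
    unfolding istopology_def by (auto simp: vimage_Int vimage_Union open_Int)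
  then show ?thesis unfolding coset_topology_def by (simp add: topology_inverse')
qed

lemma topspace_coset [simp]: "topspace (coset_topology H) = cosets H"
proof -
  have "rcoset H -` cosets H = UNIV" by (auto simp: cosets_def)
  then have "openin (coset_topology H) (cosets H)" by (simp add: openin_coset)
  then show ?thesis by (metis openin_coset openin_subset openin_topspace subset_antisym)
qed

lemma continuous_map_coset:
  fixes f :: "'g set \<Rightarrow> 'b::topological_space"
  shows "continuous_map (coset_topology H) euclidean f \<longleftrightarrow> continuous_on UNIV (\<lambda>x. f (rcoset H x))"
proof -
  have "rcoset H -` {C \<in> cosets H. f C \<in> U} = (\<lambda>x. f (rcoset H x)) -` U" for U
    by (auto simp: cosets_def)
  then show ?thesis
    by (auto simp: continuous_map_def openin_coset continuous_on_open_vimage[OF open_UNIV])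
qed

lemma continuous_map_rcoset: "continuous_map euclidean (coset_topology H) (rcoset H)"
  by (auto simp: continuous_map_def openin_coset cosets_def vimage_def)

lemma compactin_rcoset_image: "compact K \<Longrightarrow> compactin (coset_topology H) (rcoset H ` K)"
  using image_compactin[OF _ continuous_map_rcoset] by simp

lemma vimage_rcoset_image: "rcoset H -` (rcoset H ` V) = {a + b | a b. a \<in> H \<and> b \<in> V}"
proof (intro equalityI subsetI)
  fix x assume "x \<in> rcoset H -` (rcoset H ` V)"
  then obtain v where v: "v \<in> V" "rcoset H x = rcoset H v" by auto
  then show "x \<in> {a + b | a b. a \<in> H \<and> b \<in> V}" using rcoset_eqD by blast
qed (auto simp: rcoset_left)

lemma openin_rcoset_image:
  assumes "open V" shows "openin (coset_topology H) (rcoset H ` V)"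
proof -
  have "{a + b | a b. a \<in> H \<and> b \<in> V} = (\<Union>h\<in>H. (\<lambda>x. - h + x) -` V)" (is "?L = ?R")
  proof (intro equalityI subsetI)
    fix x assume "x \<in> ?R"
    then obtain h where "h \<in> H" "- h + x \<in> V" by auto
    then show "x \<in> ?L" by (intro CollectI exI[of _ h] exI[of _ "- h + x"]) (simp add: add.assoc[symmetric])
  next
    fix x assume "x \<in> ?L"
    then obtain a b where "a \<in> H" "b \<in> V" "x = a + b" by auto
    then show "x \<in> ?R" by (intro UN_I[of a]) (auto simp: add.assoc[symmetric])
  qed
  moreover have "open ((\<lambda>x. - h + x) -` V)" for h
    using assms by (intro open_vimage continuous_intros)
  ultimately show ?thesis by (auto simp: openin_coset vimage_rcoset_image cosets_def)
qed

lemma closedin_rcoset_image: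
  assumes "compact K" shows "closedin (coset_topology H) (rcoset H ` K)"
proof -
  have "rcoset H -` (cosets H - rcoset H ` K) = - {a + b | a b. a \<in> H \<and> b \<in> K}"
    unfolding vimage_rcoset_image[symmetric] by (auto simp: cosets_def)
  moreover have "closed {a + b | a b. a \<in> H \<and> b \<in> K}"
    using compact_set_sums[OF H_compact assms] compact_imp_closed by blast
  ultimately show ?thesis
    by (auto simp: closedin_def openin_coset open_Compl cosets_def)
qed

text \<open>Properness of the projection: finitely many images of relatively compact open sets cover
  \<open>K\<close>, and multiplying the corresponding compact sets by the compact group
  \<open>H\<close> captures the full preimage.\<close>

lemma compactin_coset_preimage:
  assumes "compactin (coset_topology H) K"
  obtains L where "compact L" "\<And>x. rcoset H x \<in> K \<Longrightarrow> x \<in> L"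
proof -
  have "\<exists>p. open (fst p) \<and> compact (snd p) \<and> x \<in> fst p \<and> fst p \<subseteq> snd p" for x :: 'g
    using compact_neighbourhood[of "{x}"] by (metis fst_conv snd_conv compact_sing insert_subset)
  then obtain p where p: "\<And>x::'g. open (fst (p x)) \<and> compact (snd (p x)) \<and> x \<in> fst (p x) \<and> fst (p x) \<subseteq> snd (p x)"
    by metis
  define V where "V x = rcoset H ` fst (p x)" for x
  have "K \<subseteq> \<Union>(range V)"
  proof
    fix C assume "C \<in> K"
    then have "C \<in> cosets H" using compactin_subset_topspace[OF assms] by auto
    then obtain x where "C = rcoset H x" by (auto simp: cosets_def)
    then show "C \<in> \<Union>(range V)" using p by (auto simp: V_def)
  qed
  moreover have "openin (coset_topology H) U" if "U \<in> range V" for U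
    using that p openin_rcoset_image by (auto simp: V_def)
  ultimately obtain F where F: "finite F" "F \<subseteq> range V" "K \<subseteq> \<Union>F"
    using compactinD[OF assms, of "range V"] by metis
  then obtain D where D: "finite D" "F = V ` D" by (metis finite_subset_image)
  define L where "L = {a + b | a b. a \<in> H \<and> b \<in> (\<Union>x\<in>D. snd (p x))}"
  show thesis
  proof
    show "compact L" unfolding L_def using D p by (intro compact_set_sums H_compact compact_UN) auto
    fix x assume "rcoset H x \<in> K"
    then obtain d y where d: "d \<in> D" "y \<in> fst (p d)" "rcoset H x = rcoset H y"
      using F(3) D(2) by (auto simp: V_def)
    obtain h where h: "h \<in> H" "x = h + y" using rcoset_eqD[OF d(3)] by blast
    have "y \<in> (\<Union>x\<in>D. snd (p x))" using d(1,2) p[of d] by blast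
    then show "x \<in> L" unfolding L_def using h by blast
  qed
qed

lemma space_coset_borel [simp]: "space (coset_borel H) = cosets H"
  unfolding coset_borel_def by (rule space_measure_of) (auto simp: openin_coset)

lemma openin_sets_coset_borel: "openin (coset_topology H) U \<Longrightarrow> U \<in> sets (coset_borel H)"
  unfolding coset_borel_def by (subst sets_measure_of) (auto simp: openin_coset)

lemma measurable_rcoset: "rcoset H \<in> measurable \<mu> (coset_borel H)"
  unfolding coset_borel_def
proof (rule measurable_measure_of)
  fix U assume "U \<in> {U. openin (coset_topology H) U}"
  then show "rcoset H -` U \<inter> space \<mu> \<in> sets \<mu>" by (simp add: openin_coset)
qed (auto simp: openin_coset cosets_def)

lemma continuous_map_coset_borel:
  fixes f :: "'g set \<Rightarrow> 'b::topological_space"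
  assumes "continuous_on UNIV (\<lambda>x. f (rcoset H x))"
  shows "f \<in> borel_measurable (coset_borel H)"
proof (rule borel_measurableI)
  fix S :: "'b set" assume "open S"
  moreover have "continuous_map (coset_topology H) euclidean f" using assms by (simp add: continuous_map_coset)
  ultimately have "openin (coset_topology H) {x \<in> cosets H. f x \<in> S}"
    using openin_continuous_map_preimage by fastforce
  then show "f -` S \<inter> space (coset_borel H) \<in> sets (coset_borel H)"
    by (auto dest!: openin_sets_coset_borel simp: vimage_def Int_def conj_commute)
qed

lemma sets_coset_measure [simp, measurable_cong]: "sets (coset_measure \<mu> H) = sets (coset_borel H)"
  by (simp add: coset_measure_def)

lemma space_coset_measure [simp]: "space (coset_measure \<mu> H) = cosets H"
  by (simp add: coset_measure_def)

text \<open>Meant for integrands involving \<open>rep\<close> or \<open>hecke_conv\<close>, whose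
  measurability on the coset space is not at hand.\<close>

lemma nn_integral_coset_le: "(\<integral>\<^sup>+C. g C \<partial>coset_measure \<mu> H) \<le> (\<integral>\<^sup>+x. g (rcoset H x) \<partial>\<mu>)"
  unfolding coset_measure_def by (rule nn_integral_distr_le[OF measurable_rcoset])

lemma nn_integral_coset:
  "g \<in> borel_measurable (coset_borel H) \<Longrightarrow> (\<integral>\<^sup>+C. g C \<partial>coset_measure \<mu> H) = (\<integral>\<^sup>+x. g (rcoset H x) \<partial>\<mu>)"
  unfolding coset_measure_def by (rule nn_integral_distr[OF measurable_rcoset]) simp

lemma L2sq_coset:
  "\<xi> \<in> borel_measurable (coset_borel H) \<Longrightarrow> L2sq (coset_measure \<mu> H) \<xi> = (\<integral>\<^sup>+x. ennreal ((cmod (\<xi> (rcoset H x)))\<^sup>2) \<partial>\<mu>)"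
  unfolding L2sq_def by (rule nn_integral_coset) simp

lemma hecke_spaceD:
  assumes "f \<in> hecke_space H"
  shows "continuous_on UNIV (\<lambda>x. f (rcoset H x))" "\<And>x h. h \<in> H \<Longrightarrow> f (rcoset H (x + h)) = f (rcoset H x)"
    "Cc (\<lambda>x. cmod (f (rcoset H x)))"
proof -
  show cont: "continuous_on UNIV (\<lambda>x. f (rcoset H x))"
    using assms continuous_map_coset by (auto simp: hecke_space_def)
  show "\<And>x h. h \<in> H \<Longrightarrow> f (rcoset H (x + h)) = f (rcoset H x)"
    using assms by (auto simp: hecke_space_def)
  define S where "S = {C \<in> cosets H. f C \<noteq> 0}"
  have "compactin (coset_topology H) (coset_topology H closure_of S)"
    using assms by (simp add: hecke_space_def S_def)
  then obtain L where L: "compact L" "\<And>x. rcoset H x \<in> coset_topology H closure_of S \<Longrightarrow> x \<in> L"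
    using compactin_coset_preimage by blast
  show "Cc (\<lambda>x. cmod (f (rcoset H x)))"
  proof (rule CcI[OF _ L(1)])
    show "continuous_on UNIV (\<lambda>x. cmod (f (rcoset H x)))" by (intro continuous_intros cont)
    fix x assume "cmod (f (rcoset H x)) \<noteq> 0"
    then have "rcoset H x \<in> S" by (simp add: S_def cosets_def)
    moreover have "S \<subseteq> coset_topology H closure_of S" by (intro closure_of_subset) (auto simp: S_def)
    ultimately show "x \<in> L" using L(2) by blast
  qed
qed

lemma hecke_spaceI:
  assumes cont: "continuous_on UNIV (\<lambda>x. f (rcoset H x))"
    and inv: "\<And>x h. h \<in> H \<Longrightarrow> f (rcoset H (x + h)) = f (rcoset H x)"
    and K: "compact K" "\<And>x. f (rcoset H x) \<noteq> 0 \<Longrightarrow> x \<in> K"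
  shows "f \<in> hecke_space H"
proof -
  have "{C \<in> cosets H. f C \<noteq> 0} \<subseteq> rcoset H ` K" using K(2) by (auto simp: cosets_def)
  then have "coset_topology H closure_of {C \<in> cosets H. f C \<noteq> 0} \<subseteq> rcoset H ` K"
    using closedin_rcoset_image[OF K(1)] by (rule closure_of_minimal)
  then have "compactin (coset_topology H) (coset_topology H closure_of {C \<in> cosets H. f C \<noteq> 0})"
    by (rule closed_compactin[OF compactin_rcoset_image[OF K(1)]]) (rule closedin_closure_of)
  then show ?thesis using cont inv by (simp add: hecke_space_def continuous_map_coset)
qed

text \<open>Turns the integral over cosets, written with chosen representatives, into a convolution
  on \<open>G\<close>; all later comparisons between pair and group rest on it.\<close>

lemma hecke_conv_rcoset:
  assumes f: "f \<in> hecke_space H" and \<xi>: "\<xi> \<in> borel_measurable (coset_borel H)"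
  shows "hecke_conv \<mu> H f \<xi> (rcoset H x) = (\<integral>y. f (rcoset H (x - y)) * \<xi> (rcoset H y) \<partial>\<mu>)"
proof -
  \<comment> \<open>Changing representatives multiplies the argument by an element of
    \<open>H\<close> on each side: the left one disappears in the coset, the right one by the
    invariance of \<open>f\<close>.\<close>
  have eq: "f (rcoset H (rep (rcoset H x) + - rep (rcoset H y))) = f (rcoset H (x - y))" for y
  proof -
    obtain h where h: "h \<in> H" "rep (rcoset H x) = h + x" by (rule rep_rcoset)
    obtain k where k: "k \<in> H" "rep (rcoset H y) = k + y" by (rule rep_rcoset)
    have "rep (rcoset H x) + - rep (rcoset H y) = h + (x - y + - k)"
      unfolding h k by (simp add: minus_add add.assoc diff_conv_add_uminus del: add_uminus_conv_diff)
    then show ?thesis using hecke_spaceD(2)[OF f H_minus[OF k(1)], of "x - y"] rcoset_left[OF h(1)] by metis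
  qed
  have "(\<lambda>D. f (rcoset H (rep (rcoset H x) + - rep D))) \<in> borel_measurable (coset_borel H)"
  proof (rule continuous_map_coset_borel)
    show "continuous_on UNIV (\<lambda>y. f (rcoset H (rep (rcoset H x) + - rep (rcoset H y))))"
      unfolding eq by (rule continuous_on_compose2[OF hecke_spaceD(1)[OF f]]) (auto intro!: continuous_intros)
  qed
  then have "(\<lambda>D. f (rcoset H (rep (rcoset H x) + - rep D)) * \<xi> D) \<in> borel_measurable (coset_borel H)"
    using \<xi> by simp
  then show ?thesis
    unfolding hecke_conv_def coset_measure_def by (subst integral_distr[OF measurable_rcoset]) (simp_all only: eq)
qed

lemma length_function_invariant:
  assumes "length_function H l" "h \<in> H"
  shows "l (h + x) = l x" "l (x + h) = l x"
proof -
  have l: "\<And>x. l (- x) = l x" "\<And>x y. l (x + y) \<le> l x + l y" "\<And>h. h \<in> H \<Longrightarrow> l h = 0"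
    using assms(1) by (auto simp: length_function_def)
  have "l x \<le> l (h + x)"
    using l(2)[of "- h" "h + x"] l(1)[of h] l(3)[OF assms(2)] by (simp add: add.assoc[symmetric])
  moreover have "l x \<le> l (x + h)"
    using l(2)[of "x + h" "- h"] l(1)[of h] l(3)[OF assms(2)] by simp
  moreover have "l (h + x) \<le> l x" "l (x + h) \<le> l x"
    using l(2)[of h x] l(2)[of x h] l(3)[OF assms(2)] by simp_all
  ultimately show "l (h + x) = l x" "l (x + h) = l x" by simp_all
qed

lemma length_rep_rcoset: "length_function H l \<Longrightarrow> l (rep (rcoset H x)) = l x"
  using rep_rcoset[of x] length_function_invariant(1) by metis

lemma length_bounded_on_compact:
  assumes "locally_bounded_length H l" "compact K"
  shows "\<exists>B. \<forall>x\<in>K. l x \<le> B"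
  using assms compactin_rcoset_image[OF assms(2)] unfolding locally_bounded_length_def by blast

end

section \<open>The trivial subgroup\<close>

context haar_group
begin

lemma haar_pair_zero: "haar_pair \<mu> {0}"
  by unfold_locales (auto simp: compact_subgroup_def)

lemma cosets_zero: "cosets {0::'g} = range (\<lambda>x. {x})"
  by (simp add: cosets_def)

text \<open>For the trivial subgroup \<open>rep\<close> inverts the projection onto singletons, so
  it is continuous.\<close>

lemma measurable_rep: "rep \<in> measurable (coset_measure \<mu> {0}) borel"
proof -
  interpret Z: haar_pair \<mu> "{0}" by (rule haar_pair_zero)
  have "(rep :: 'g set \<Rightarrow> 'g) \<in> borel_measurable (coset_borel {0})"
    by (rule Z.continuous_map_coset_borel) simp
  then show ?thesis by (simp cong: measurable_cong_sets)
qed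

text \<open>Apply the one-sided inequality for image measures to the projection and to its inverse
  \<open>rep\<close>; thus equality holds even for integrands of unknown measurability.\<close>

lemma nn_integral_coset_zero: "(\<integral>\<^sup>+C. g C \<partial>coset_measure \<mu> {0}) = (\<integral>\<^sup>+x. g {x} \<partial>\<mu>)"
proof (rule antisym)
  interpret Z: haar_pair \<mu> "{0}" by (rule haar_pair_zero)
  show "(\<integral>\<^sup>+C. g C \<partial>coset_measure \<mu> {0}) \<le> (\<integral>\<^sup>+x. g {x} \<partial>\<mu>)"
    using Z.nn_integral_coset_le[of g] by simp
  have "distr (coset_measure \<mu> {0}) borel rep = distr \<mu> borel (\<lambda>x. x)"
    unfolding coset_measure_def using measurable_rep Z.measurable_rcoset
    by (subst distr_distr) (auto simp: o_def coset_measure_def cong: measurable_cong_sets)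
  also have "\<dots> = \<mu>" by (rule distr_id2) simp
  finally have eq: "distr (coset_measure \<mu> {0}) borel rep = \<mu>" .
  have "(\<integral>\<^sup>+x. g {x} \<partial>\<mu>) \<le> (\<integral>\<^sup>+C. g {rep C} \<partial>coset_measure \<mu> {0})"
    using nn_integral_distr_le[OF measurable_rep, of "\<lambda>x. g {x}"] by (simp add: eq)
  also have "\<dots> = (\<integral>\<^sup>+C. g C \<partial>coset_measure \<mu> {0})"
    by (rule nn_integral_cong) (auto simp: cosets_zero)
  finally show "(\<integral>\<^sup>+x. g {x} \<partial>\<mu>) \<le> (\<integral>\<^sup>+C. g C \<partial>coset_measure \<mu> {0})" .
qed

lemma L2sq_coset_zero: "L2sq (coset_measure \<mu> {0}) \<xi> = (\<integral>\<^sup>+x. ennreal ((cmod (\<xi> {x}))\<^sup>2) \<partial>\<mu>)"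
  unfolding L2sq_def by (rule nn_integral_coset_zero)

end

section \<open>From the group to the pair\<close>

lemma powr_weight_mono:
  fixes a b A s :: real
  assumes "s > 0" "a \<ge> 0" "b \<ge> 0" "A \<ge> 0" "1 + a \<le> A * (1 + b)"
  shows "(1 + a) powr (2 * s) \<le> A powr (2 * s) * (1 + b) powr (2 * s)"
  using powr_mono2[of "2 * s" "1 + a" "A * (1 + b)"] assms by (simp add: powr_mult)

lemma powr_square: "(A powr s)\<^sup>2 = A powr (2 * s)" for A s :: real
  by (simp add: power2_eq_square flip: powr_add)

context haar_pair
begin

text \<open>Averaging \<open>l\<close> over \<open>H\<close> would raise measurability questions; the infimum over an open,
  relatively compact, \<open>H\<close>-biinvariant neighbourhood \<open>W\<close> of \<open>H\<close> is upper semicontinuous for free and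
  changes \<open>l\<close> only by a bounded amount. It is subadditive up to a constant, which is absorbed by
  a jump off \<open>H\<close>.\<close>

lemma extend_length:
  assumes l: "length_function {0} l" and bdd: "\<And>K. compact K \<Longrightarrow> \<exists>B. \<forall>x\<in>K. l x \<le> B"
  obtains l' A where "length_function H l'" "locally_bounded_length H l'"
    "(\<lambda>C. l' (rep C)) \<in> borel_measurable (coset_borel H)" "A \<ge> 1" "\<And>x. 1 + l x \<le> A * (1 + l' x)"
proof -
  have l0: "\<And>x. l x \<ge> 0" and lm: "\<And>x. l (- x) = l x" and la: "\<And>x y. l (x + y) \<le> l x + l y"
    using l by (auto simp: length_function_def)
  obtain V L where VL: "open V" "compact L" "{0::'g} \<subseteq> V" "V \<subseteq> L" by (rule compact_neighbourhood[of "{0}"]) auto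
  \<comment> \<open>Symmetry of \<open>U\<close> passes to \<open>W\<close> and yields
    \<open>q (- g) = q g\<close>.\<close>
  define U where "U = V \<inter> uminus -` V"
  have U: "open U" unfolding U_def using VL(1) by (intro open_Int open_vimage continuous_intros)
  have U0: "0 \<in> U" "U \<subseteq> L" using VL(3,4) by (auto simp: U_def)
  have Um: "- u \<in> U" if "u \<in> U" for u using that by (simp add: U_def)
  define W where "W = {h + u + k | h u k. h \<in> H \<and> u \<in> U \<and> k \<in> H}"
  have WI: "h + u + k \<in> W" if "h \<in> H" "u \<in> U" "k \<in> H" for h u k using that by (auto simp: W_def)
  have WE: "\<exists>h u k. h \<in> H \<and> u \<in> U \<and> k \<in> H \<and> w = h + u + k" if "w \<in> W" for w using that by (auto simp: W_def)
  have W_open: "open W"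
  proof -
    have "W = (\<Union>h\<in>H. \<Union>k\<in>H. (\<lambda>w. - h + w + - k) -` U)" (is "_ = ?R")
    proof (intro equalityI subsetI)
      fix w assume "w \<in> W"
      then obtain h u k where w: "h \<in> H" "u \<in> U" "k \<in> H" "w = h + u + k" using WE by blast
      have "- h + w + - k = u" unfolding w(4) by (simp add: add.assoc[symmetric])
      then show "w \<in> ?R" using w by (intro UN_I[OF w(1)] UN_I[OF w(3)]) simp
    next
      fix w assume "w \<in> ?R"
      then obtain h k where w: "h \<in> H" "k \<in> H" "- h + w + - k \<in> U" by auto
      have "w = h + (- h + w + - k) + k" by (simp add: add.assoc[symmetric] diff_conv_add_uminus del: add_uminus_conv_diff) (simp add: add.assoc)
      then show "w \<in> W" using WI[OF w(1,3,2)] by simp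
    qed
    moreover have "open ((\<lambda>w. - h + w + - k) -` U)" for h k using U by (intro open_vimage continuous_intros)
    ultimately show ?thesis by auto
  qed
  have W0: "0 \<in> W" using WI[of 0 0 0] U0 by simp
  have Wm: "- w \<in> W" if w: "w \<in> W" for w
  proof -
    obtain h u k where w: "h \<in> H" "u \<in> U" "k \<in> H" "w = h + u + k" using WE[OF w] by blast
    have "- w = - k + - u + - h" unfolding w(4) by (simp add: minus_add add.assoc del: add_uminus_conv_diff)
    then show ?thesis using WI[of "- k" "- u" "- h"] w H_minus Um by simp
  qed
  have WH: "w + h \<in> W" if wW: "w \<in> W" and hH: "h \<in> H" for w h
  proof -
    obtain h' u k where w: "h' \<in> H" "u \<in> U" "k \<in> H" "w = h' + u + k" using WE[OF wW] by blast
    have "w + h = h' + u + (k + h)" unfolding w(4) by (simp add: add.assoc)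
    then show ?thesis using WI[of h' u "k + h"] w H_add hH by simp
  qed
  obtain M where M: "\<And>w. w \<in> W \<Longrightarrow> l w \<le> M" "M \<ge> 0"
  proof -
    define LL where "LL = {a + b | a b. a \<in> {a + b | a b. a \<in> H \<and> b \<in> L} \<and> b \<in> H}"
    have "compact LL" unfolding LL_def by (intro compact_set_sums H_compact VL(2))
    then obtain B where B: "\<And>x. x \<in> LL \<Longrightarrow> l x \<le> B" using bdd by blast
    have "w \<in> LL" if "w \<in> W" for w
    proof -
      obtain h u k where w: "h \<in> H" "u \<in> U" "k \<in> H" "w = h + u + k" using WE[OF \<open>w \<in> W\<close>] by blast
      then have "h + u \<in> {a + b | a b. a \<in> H \<and> b \<in> L}" using U0(2) by blast
      then show ?thesis unfolding LL_def using w(3,4) by blast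
    qed
    then show thesis using that[of "max 0 B"] B by (simp add: le_max_iff_disj)
  qed
  define q where "q g = (INF z\<in>W \<times> W. l (fst z + g + snd z))" for g
  have WW: "W \<times> W \<noteq> {}" using W0 by blast
  have bdb: "bdd_below ((\<lambda>z. l (fst z + g + snd z)) ` (W \<times> W))" for g
    using l0 by (intro bdd_belowI[of _ 0]) auto
  have q_le: "q g \<le> l (a + g + b)" if "a \<in> W" "b \<in> W" for g a b
    unfolding q_def using cINF_lower[OF bdb, of "(a, b)" g] that by simp
  have q_ge: "t \<le> q g" if "\<And>a b. a \<in> W \<Longrightarrow> b \<in> W \<Longrightarrow> t \<le> l (a + g + b)" for t g
    unfolding q_def using that by (intro cINF_greatest[OF WW]) auto
  have q0: "q g \<ge> 0" for g using l0 by (intro q_ge)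
  have ql: "q g \<le> l g" for g using q_le[OF W0 W0, of g] by simp
  have lq: "l g \<le> q g + 2 * M" for g
  proof -
    have "l g - 2 * M \<le> q g"
    proof (rule q_ge)
      fix a b assume ab: "a \<in> W" "b \<in> W"
      have "g = - a + ((a + g + b) + - b)"
        by (simp add: add.assoc[symmetric])
      then have "l g \<le> l (- a) + (l (a + g + b) + l (- b))"
        using la[of "- a" "(a + g + b) + - b"] la[of "a + g + b" "- b"] by simp
      then show "l g - 2 * M \<le> l (a + g + b)" using M(1)[OF ab(1)] M(1)[OF ab(2)] lm by simp
    qed
    then show ?thesis by simp
  qed
  have qm1: "q (- g) \<le> q g" for g
  proof (rule q_ge)
    fix a b assume ab: "a \<in> W" "b \<in> W"
    have "q (- g) \<le> l (- b + - g + - a)" using ab Wm by (intro q_le) auto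
    also have "- b + - g + - a = - (a + g + b)" by (simp add: minus_add add.assoc del: add_uminus_conv_diff)
    finally show "q (- g) \<le> l (a + g + b)" by (simp add: lm)
  qed
  have qm: "q (- g) = q g" for g using qm1[of g] qm1[of "- g"] by simp
  have qh1: "q (h + g) \<le> q g" if h: "h \<in> H" for h g
  proof (rule q_ge)
    fix a b assume ab: "a \<in> W" "b \<in> W"
    have "q (h + g) \<le> l ((a + - h) + (h + g) + b)" by (intro q_le WH ab H_minus h)
    also have "(a + - h) + (h + g) + b = a + g + b" by (simp add: add.assoc[symmetric])
    finally show "q (h + g) \<le> l (a + g + b)" .
  qed
  have qh: "q (h + g) = q g" if h: "h \<in> H" for h g
    using qh1[OF h, of g] qh1[OF H_minus[OF h], of "h + g"] by (simp add: add.assoc[symmetric])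
  have qh': "q (g + h) = q g" if h: "h \<in> H" for h g
    using qh[OF H_minus[OF h], of "- g"] qm[of "g + h"] qm[of g] by (simp add: minus_add)
  have q_open: "open {g. q g < t}" for t
  proof -
    \<comment> \<open>Writing \<open>y = a + g + b\<close>, the condition on \<open>g\<close> is
      that \<open>a = y - b - g\<close> lies in the open set \<open>W\<close>; so openness comes
      from \<open>W\<close> alone, with no regularity of \<open>l\<close>.\<close>
    have eq: "{g. q g < t} = (\<Union>b\<in>W. \<Union>y\<in>{y. l y < t}. (\<lambda>g. y - b - g) -` W)" (is "_ = ?R")
    proof (intro equalityI subsetI)
      fix g assume "g \<in> {g. q g < t}"
      then obtain a b where ab: "a \<in> W" "b \<in> W" "l (a + g + b) < t"
        using cINF_less_iff[OF WW bdb, of g t] by (auto simp: q_def)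
      then show "g \<in> ?R" by (intro UN_I[OF ab(2)] UN_I[of "a + g + b"]) auto
    next
      fix g assume "g \<in> ?R"
      then obtain b y where bw: "b \<in> W" "l y < t" "y - b - g \<in> W" by auto
      have "q g \<le> l (y - b - g + g + b)" using bw by (intro q_le)
      then show "g \<in> {g. q g < t}" using bw(2) by simp
    qed
    show ?thesis unfolding eq using W_open by (intro open_UN ballI open_vimage continuous_intros)
  qed
  have q_borel: "q \<in> borel_measurable borel"
    unfolding borel_measurable_iff_less using q_open by auto
  \<comment> \<open>Passing from \<open>l\<close> back to \<open>q\<close> costs
    \<open>2 * M\<close> for each of the two summands, so subadditivity of \<open>q\<close> fails by
    at most \<open>4 * M\<close>.\<close>
  define l' where "l' g = (if g \<in> H then 0 else q g + 4 * M)" for g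
  have Hb: "H \<in> sets borel" using H_compact by (rule borel_compact)
  show thesis
  proof
    show "length_function H l'"
      unfolding length_function_def
    proof (intro conjI allI ballI)
      show "l' \<in> borel_measurable borel"
        unfolding l'_def using Hb q_borel by (intro measurable_If) auto
      show "l' g \<ge> 0" for g using q0 M(2) by (simp add: l'_def)
      show "l' 0 = 0" by (simp add: l'_def)
      have "- g \<in> H \<longleftrightarrow> g \<in> H" for g using H_minus[of g] H_minus[of "- g"] by auto
      then show "l' (- g) = l' g" for g by (simp add: l'_def qm)
      show "l' h = 0" if "h \<in> H" for h using that by (simp add: l'_def)
      fix g h
      consider "g \<in> H" "h \<in> H" | "g \<in> H" "h \<notin> H" | "g \<notin> H" "h \<in> H" | "g \<notin> H" "h \<notin> H" by blast
      then show "l' (g + h) \<le> l' g + l' h"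
      proof cases
        case 1 then show ?thesis by (simp add: l'_def H_add)
      next
        case 2 then show ?thesis using q0[of h] M(2) by (simp add: l'_def qh)
      next
        case 3 then show ?thesis using q0[of g] M(2) by (simp add: l'_def qh')
      next
        case 4
        have "q (g + h) \<le> q g + q h + 4 * M"
          using ql[of "g + h"] la[of g h] lq[of g] lq[of h] by simp
        then show ?thesis using 4 q0[of g] q0[of h] M(2) by (simp add: l'_def)
      qed
    qed
    show "locally_bounded_length H l'"
      unfolding locally_bounded_length_def
    proof (intro allI impI)
      fix K assume "compactin (coset_topology H) K"
      then obtain L' where L': "compact L'" "\<And>x. rcoset H x \<in> K \<Longrightarrow> x \<in> L'"
        using compactin_coset_preimage by blast
      obtain B where B: "\<And>x. x \<in> L' \<Longrightarrow> l x \<le> B" using bdd[OF L'(1)] by blast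
      have "l' x \<le> max 0 (B + 4 * M)" if "rcoset H x \<in> K" for x
        using B[OF L'(2)[OF that]] ql[of x] by (simp add: l'_def le_max_iff_disj)
      then show "\<exists>B. \<forall>x. rcoset H x \<in> K \<longrightarrow> l' x \<le> B" by blast
    qed
    \<comment> \<open>The sublevel sets of \<open>q\<close> are open and unions of cosets, hence
      open in the quotient. Borel sets with the same saturation would not descend so
      directly.\<close>
    show "(\<lambda>C. l' (rep C)) \<in> borel_measurable (coset_borel H)"
    proof -
      have qr: "q (rep (rcoset H x)) = q x" for x
        using rep_rcoset[of x] qh by metis
      have "(\<lambda>C. q (rep C)) \<in> borel_measurable (coset_borel H)"
        unfolding borel_measurable_iff_less
      proof
        fix t
        have "rcoset H -` {C \<in> cosets H. q (rep C) < t} = {x. q x < t}"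
          by (auto simp: cosets_def qr)
        then have "openin (coset_topology H) {C \<in> cosets H. q (rep C) < t}"
          using q_open by (simp add: openin_coset)
        then show "{C \<in> space (coset_borel H). q (rep C) < t} \<in> sets (coset_borel H)"
          using openin_sets_coset_borel by simp
      qed
      moreover have "{C \<in> space (coset_borel H). rep C \<in> H} \<in> sets (coset_borel H)"
      proof -
        have "rcoset H -` {C \<in> cosets H. rep C \<notin> H} = - H"
        proof -
          have "rep (rcoset H x) \<in> H \<longleftrightarrow> x \<in> H" for x
          proof -
            obtain h where h: "h \<in> H" "rep (rcoset H x) = h + x" by (rule rep_rcoset)
            show ?thesis unfolding h(2) using H_add[OF h(1), of x] H_add[OF H_minus[OF h(1)], of "h + x"]
              by (auto simp: add.assoc[symmetric])
          qed
          then show ?thesis by (auto simp: cosets_def)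
        qed
        then have "openin (coset_topology H) {C \<in> cosets H. rep C \<notin> H}"
          using H_compact compact_imp_closed by (auto simp: openin_coset)
        then have "{C \<in> cosets H. rep C \<notin> H} \<in> sets (coset_borel H)" by (rule openin_sets_coset_borel)
        then have "space (coset_borel H) - {C \<in> cosets H. rep C \<notin> H} \<in> sets (coset_borel H)" by blast
        moreover have "space (coset_borel H) - {C \<in> cosets H. rep C \<notin> H} = {C \<in> space (coset_borel H). rep C \<in> H}"
          by auto
        ultimately show ?thesis by simp
      qed
      ultimately show ?thesis unfolding l'_def by (intro measurable_If) auto
    qed
    show "1 + 2 * M \<ge> 1" using M(2) by simp
    \<comment> \<open>On \<open>H\<close> the new length is 0, but \<open>H\<close> lies in
      \<open>W\<close>, where \<open>l\<close> is at most \<open>M\<close>.\<close>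
    show "1 + l x \<le> (1 + 2 * M) * (1 + l' x)" for x
    proof (cases "x \<in> H")
      case True
      then have "x \<in> W" using WH[OF W0, of x] by simp
      then show ?thesis using True M by (simp add: l'_def add.commute mult.commute) (use M in \<open>fastforce\<close>)
    next
      case False
      have "1 + l x \<le> 1 + q x + 2 * M" using lq[of x] by simp
      also have "\<dots> \<le> (1 + 2 * M) * (1 + q x)" using M(2) q0[of x] by (simp add: algebra_simps)
      also have "\<dots> \<le> (1 + 2 * M) * (1 + l' x)" using M(2) False by (intro mult_left_mono) (auto simp: l'_def)
      finally show ?thesis .
    qed
  qed
qed

lemma RD_pair_if_RD_group:
  assumes "RD_pair \<mu> {0}" shows "RD_pair \<mu> H"
proof -
  interpret Z: haar_pair \<mu> "{0}" by (rule haar_pair_zero)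
  obtain l s c where l: "length_function {0} l" "locally_bounded_length {0} l" and s: "s > 0" and c: "c > 0"
    and rd: "\<And>f \<xi>. f \<in> hecke_space {0} \<Longrightarrow> \<xi> \<in> L2_space (coset_measure \<mu> {0}) \<Longrightarrow>
           L2sq (coset_measure \<mu> {0}) (hecke_conv \<mu> {0} f \<xi>)
             \<le> ennreal (c\<^sup>2) *
               (\<integral>\<^sup>+ C. ennreal ((cmod (f C))\<^sup>2 * (1 + l (rep C)) powr (2 * s)) \<partial>coset_measure \<mu> {0}) *
               L2sq (coset_measure \<mu> {0}) \<xi>"
    using assms unfolding RD_pair_def by blast
  have l0: "l x \<ge> 0" for x using l(1) by (simp add: length_function_def)
  obtain l' A where l': "length_function H l'" "locally_bounded_length H l'"
    "(\<lambda>C. l' (rep C)) \<in> borel_measurable (coset_borel H)" and A: "A \<ge> 1" "\<And>x. 1 + l x \<le> A * (1 + l' x)"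
    using extend_length[OF l(1) Z.length_bounded_on_compact[OF l(2)]] by blast
  have l'0: "l' x \<ge> 0" for x using l'(1) by (simp add: length_function_def)
  \<comment> \<open>Replacing \<open>1 + l\<close> by \<open>A * (1 + l')\<close> costs
    \<open>A powr (2 * s)\<close> in the squared norm, hence a factor \<open>A powr s\<close> in the
    constant.\<close>
  have "L2sq (coset_measure \<mu> H) (hecke_conv \<mu> H f \<xi>)
     \<le> ennreal ((c * A powr s)\<^sup>2) *
       (\<integral>\<^sup>+ C. ennreal ((cmod (f C))\<^sup>2 * (1 + l' (rep C)) powr (2 * s)) \<partial>coset_measure \<mu> H) *
       L2sq (coset_measure \<mu> H) \<xi>"
    if f: "f \<in> hecke_space H" and \<xi>: "\<xi> \<in> L2_space (coset_measure \<mu> H)" for f \<xi>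
  proof -
    \<comment> \<open>Cosets of the trivial subgroup are singletons, and \<open>rep {x} = x\<close>;
      so \<open>F\<close> and \<open>X\<close> are the pullbacks of \<open>f\<close> and \<xi> along
      the projection.\<close>
    define F where "F C = f (rcoset H (rep C))" for C
    define X where "X C = \<xi> (rcoset H (rep C))" for C
    have fm: "f \<in> borel_measurable (coset_borel H)"
      by (rule continuous_map_coset_borel[OF hecke_spaceD(1)[OF f]])
    have \<xi>m: "\<xi> \<in> borel_measurable (coset_borel H)" using \<xi> by (simp add: L2_space_def cong: measurable_cong_sets)
    obtain K where K: "compact K" "\<And>x. cmod (f (rcoset H x)) \<noteq> 0 \<Longrightarrow> x \<in> K"
      using Cc_supportE[OF hecke_spaceD(3)[OF f]] by blast
    have F: "F \<in> hecke_space {0}"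
      by (rule Z.hecke_spaceI[OF _ _ K(1)]) (use K(2) hecke_spaceD(1)[OF f] in \<open>auto simp: F_def\<close>)
    have "rcoset H \<in> measurable borel (coset_borel H)" using measurable_rcoset by (simp cong: measurable_cong_sets)
    then have "(\<lambda>x. \<xi> (rcoset H x)) \<in> borel_measurable borel" using \<xi>m by (rule measurable_compose)
    then have Xm': "X \<in> borel_measurable (coset_measure \<mu> {0})"
      unfolding X_def using measurable_rep by (rule measurable_compose[rotated])
    then have Xm: "X \<in> borel_measurable (coset_borel {0})" by (simp cong: measurable_cong_sets)
    have XL: "L2sq (coset_measure \<mu> {0}) X = L2sq (coset_measure \<mu> H) \<xi>"
      unfolding L2sq_coset_zero L2sq_coset[OF \<xi>m] by (simp add: X_def)
    have X: "X \<in> L2_space (coset_measure \<mu> {0})" using Xm' XL \<xi> by (simp add: L2_space_def)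
    have W: "(\<integral>\<^sup>+ C. ennreal ((cmod (F C))\<^sup>2 * (1 + l (rep C)) powr (2 * s)) \<partial>coset_measure \<mu> {0})
      \<le> ennreal (A powr (2 * s)) * (\<integral>\<^sup>+ C. ennreal ((cmod (f C))\<^sup>2 * (1 + l' (rep C)) powr (2 * s)) \<partial>coset_measure \<mu> H)"
    proof -
      have "(\<integral>\<^sup>+ C. ennreal ((cmod (F C))\<^sup>2 * (1 + l (rep C)) powr (2 * s)) \<partial>coset_measure \<mu> {0})
        = (\<integral>\<^sup>+x. ennreal ((cmod (f (rcoset H x)))\<^sup>2 * (1 + l x) powr (2 * s)) \<partial>\<mu>)"
        by (simp add: nn_integral_coset_zero F_def)
      also have "\<dots> \<le> (\<integral>\<^sup>+x. ennreal (A powr (2 * s) * ((cmod (f (rcoset H x)))\<^sup>2 * (1 + l' (rep (rcoset H x))) powr (2 * s))) \<partial>\<mu>)"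
      proof (intro nn_integral_mono ennreal_leI)
        fix x
        have "(cmod (f (rcoset H x)))\<^sup>2 * (1 + l x) powr (2 * s)
          \<le> (cmod (f (rcoset H x)))\<^sup>2 * (A powr (2 * s) * (1 + l' x) powr (2 * s))"
          using A s l0 l'0 by (intro mult_left_mono powr_weight_mono) auto
        then show "(cmod (f (rcoset H x)))\<^sup>2 * (1 + l x) powr (2 * s)
          \<le> A powr (2 * s) * ((cmod (f (rcoset H x)))\<^sup>2 * (1 + l' (rep (rcoset H x))) powr (2 * s))"
          by (simp add: length_rep_rcoset[OF l'(1)] mult_ac)
      qed
      \<comment> \<open>Here an integral over \<open>G\<close> must be bounded by one over the coset
        space, opposite to \<open>nn_integral_coset_le\<close>; this is what the measurability of
        \<open>l'\<close> on representatives is for.\<close>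
      also have "\<dots> = (\<integral>\<^sup>+ C. ennreal (A powr (2 * s) * ((cmod (f C))\<^sup>2 * (1 + l' (rep C)) powr (2 * s))) \<partial>coset_measure \<mu> H)"
        by (rule nn_integral_coset[symmetric]) (use fm l'(3) in measurable)
      also have "\<dots> = (\<integral>\<^sup>+ C. ennreal (A powr (2 * s)) * ennreal ((cmod (f C))\<^sup>2 * (1 + l' (rep C)) powr (2 * s)) \<partial>coset_measure \<mu> H)"
        by (intro nn_integral_cong ennreal_mult) auto
      also have "\<dots> = ennreal (A powr (2 * s)) * (\<integral>\<^sup>+ C. ennreal ((cmod (f C))\<^sup>2 * (1 + l' (rep C)) powr (2 * s)) \<partial>coset_measure \<mu> H)"
        by (rule nn_integral_cmult) (use fm l'(3) in measurable)
      finally show ?thesis .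
    qed
    have "L2sq (coset_measure \<mu> H) (hecke_conv \<mu> H f \<xi>)
      \<le> (\<integral>\<^sup>+x. ennreal ((cmod (hecke_conv \<mu> H f \<xi> (rcoset H x)))\<^sup>2) \<partial>\<mu>)"
      unfolding L2sq_def by (rule nn_integral_coset_le)
    also have "\<dots> = (\<integral>\<^sup>+x. ennreal ((cmod (hecke_conv \<mu> {0} F X {x}))\<^sup>2) \<partial>\<mu>)"
      using Z.hecke_conv_rcoset[OF F Xm] by (simp add: hecke_conv_rcoset[OF f \<xi>m] F_def X_def)
    also have "\<dots> = L2sq (coset_measure \<mu> {0}) (hecke_conv \<mu> {0} F X)" by (simp add: L2sq_coset_zero)
    also have "\<dots> \<le> ennreal (c\<^sup>2) *
       (\<integral>\<^sup>+ C. ennreal ((cmod (F C))\<^sup>2 * (1 + l (rep C)) powr (2 * s)) \<partial>coset_measure \<mu> {0}) *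
       L2sq (coset_measure \<mu> {0}) X" by (rule rd[OF F X])
    also have "\<dots> \<le> ennreal (c\<^sup>2) *
       (ennreal (A powr (2 * s)) * (\<integral>\<^sup>+ C. ennreal ((cmod (f C))\<^sup>2 * (1 + l' (rep C)) powr (2 * s)) \<partial>coset_measure \<mu> H)) *
       L2sq (coset_measure \<mu> H) \<xi>"
      unfolding XL by (intro mult_right_mono mult_left_mono W) auto
    finally show ?thesis by (simp add: power_mult_distrib powr_square ennreal_mult mult.assoc)
  qed
  then show ?thesis
    unfolding RD_pair_def using l' s c A(1)
    by (intro exI[of _ l'] exI[of _ s] exI[of _ "c * A powr s"]) auto
qed

end

section \<open>From the pair to the group\<close>

context haar_group
begin

text \<open>The hypothesis on \<open>w\<close> moves the weight from \<open>z\<close> to the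
  argument at which \<open>f\<close> is evaluated, at the price of \<open>D\<close>. The weighted
  function is then averaged as a whole, and the two averages contribute one constant each.\<close>

lemma smear_weight_le:
  assumes \<psi>: "Cc \<psi>" "\<And>x. \<psi> x \<ge> 0" and f: "Cc f"
    and w: "continuous_on UNIV w" "\<And>x. w x \<ge> 0"
    and D: "D \<ge> 0" "\<And>u v z. \<psi> u \<noteq> 0 \<Longrightarrow> \<psi> v \<noteq> 0 \<Longrightarrow> w z \<le> D * w (u + z - v)"
  defines "R \<equiv> smear \<psi> (rsmear \<psi> (\<lambda>x. (f x)\<^sup>2))"
  shows "(\<integral>z. R z * w z \<partial>\<mu>) \<le> D * ((\<integral>y. \<psi> (- y) \<partial>\<mu>) * ((\<integral>y. \<psi> y \<partial>\<mu>) * (\<integral>y. (f y)\<^sup>2 * w y \<partial>\<mu>)))"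
proof -
  define F where "F = (\<lambda>y. (f y)\<^sup>2 * w y)"
  have F: "Cc F" unfolding F_def by (intro Cc_mult_left Cc_power2 f w)
  have f2: "Cc (\<lambda>x. (f x)\<^sup>2)" by (intro Cc_power2 f)
  have P1: "Cc (rsmear \<psi> (\<lambda>x. (f x)\<^sup>2))" and P2: "Cc (rsmear \<psi> F)" by (intro Cc_rsmear \<psi> f2 F)+
  have R: "Cc R" unfolding R_def by (intro Cc_smear \<psi> P1)
  have ker: "Cc (\<lambda>v. \<psi> v * g (t - v))" if "Cc g" for g t
    using Cc_section[OF Cc_conv_kernel'[OF \<psi>(1) that], of t] by simp
  have ker2: "Cc (\<lambda>v. \<psi> v * g (v + t))" if "Cc g" for g t
    using Cc_section[OF Cc_corr_kernel[OF \<psi>(1) that], of t] by simp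
  have P_le: "w z * rsmear \<psi> (\<lambda>x. (f x)\<^sup>2) (u + z) \<le> D * rsmear \<psi> F (u + z)" if "\<psi> u \<noteq> 0" for u z
  proof -
    have "w z * rsmear \<psi> (\<lambda>x. (f x)\<^sup>2) (u + z) = (\<integral>v. w z * (\<psi> v * (f (u + z - v))\<^sup>2) \<partial>\<mu>)"
      by (simp add: rsmear_def)
    also have "\<dots> \<le> (\<integral>v. D * (\<psi> v * F (u + z - v)) \<partial>\<mu>)"
    proof (rule integral_mono)
      show "integrable \<mu> (\<lambda>v. w z * (\<psi> v * (f (u + z - v))\<^sup>2))"
        by (intro Cc_integrable Cc_cmult ker[OF f2])
      show "integrable \<mu> (\<lambda>v. D * (\<psi> v * F (u + z - v)))"
        by (intro Cc_integrable Cc_cmult ker[OF F])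
      show "w z * (\<psi> v * (f (u + z - v))\<^sup>2) \<le> D * (\<psi> v * F (u + z - v))" for v
      proof (cases "\<psi> v = 0")
        case False
        have "w z * (\<psi> v * (f (u + z - v))\<^sup>2) \<le> (D * w (u + z - v)) * (\<psi> v * (f (u + z - v))\<^sup>2)"
          using D(2)[OF that False] \<psi>(2) by (intro mult_right_mono) auto
        then show ?thesis by (simp add: F_def mult_ac)
      qed simp
    qed
    also have "\<dots> = D * rsmear \<psi> F (u + z)" by (simp add: rsmear_def)
    finally show ?thesis .
  qed
  have "(\<integral>z. R z * w z \<partial>\<mu>) \<le> (\<integral>z. D * smear \<psi> (rsmear \<psi> F) z \<partial>\<mu>)"
  proof (rule integral_mono)
    show "integrable \<mu> (\<lambda>z. R z * w z)" by (intro Cc_integrable Cc_mult_left R w)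
    show "integrable \<mu> (\<lambda>z. D * smear \<psi> (rsmear \<psi> F) z)"
      by (intro Cc_integrable Cc_cmult Cc_smear \<psi> P2)
    fix z
    have "R z * w z = (\<integral>u. w z * (\<psi> u * rsmear \<psi> (\<lambda>x. (f x)\<^sup>2) (u + z)) \<partial>\<mu>)"
      by (simp add: R_def smear_def mult.commute)
    also have "\<dots> \<le> (\<integral>u. D * (\<psi> u * rsmear \<psi> F (u + z)) \<partial>\<mu>)"
    proof (rule integral_mono)
      show "integrable \<mu> (\<lambda>u. w z * (\<psi> u * rsmear \<psi> (\<lambda>x. (f x)\<^sup>2) (u + z)))"
        by (intro Cc_integrable Cc_cmult ker2[OF P1])
      show "integrable \<mu> (\<lambda>u. D * (\<psi> u * rsmear \<psi> F (u + z)))"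
        by (intro Cc_integrable Cc_cmult ker2[OF P2])
      show "w z * (\<psi> u * rsmear \<psi> (\<lambda>x. (f x)\<^sup>2) (u + z)) \<le> D * (\<psi> u * rsmear \<psi> F (u + z))" for u
      proof (cases "\<psi> u = 0")
        case False
        have "\<psi> u * (w z * rsmear \<psi> (\<lambda>x. (f x)\<^sup>2) (u + z)) \<le> \<psi> u * (D * rsmear \<psi> F (u + z))"
          using P_le[OF False] \<psi>(2) by (intro mult_left_mono) auto
        then show ?thesis by (simp add: mult_ac)
      qed simp
    qed
    also have "\<dots> = D * smear \<psi> (rsmear \<psi> F) z" by (simp add: smear_def)
    finally show "R z * w z \<le> D * smear \<psi> (rsmear \<psi> F) z" .
  qed
  also have "\<dots> = D * ((\<integral>y. \<psi> (- y) \<partial>\<mu>) * ((\<integral>y. \<psi> y \<partial>\<mu>) * (\<integral>y. F y \<partial>\<mu>)))"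
    by (simp add: integral_smear[OF \<psi>(1) P2] integral_rsmear[OF \<psi>(1) F])
  finally show ?thesis by (simp add: F_def)
qed

end

context haar_pair
begin

text \<open>Apply (RD) for the pair to the averaged functions. On the right, the average of
  \<open>f\<close> contributes \<open>D * \<kappa> * I\<close> and that of \<xi> a factor \<kappa>;
  on the left three factors \<kappa> appear. This leaves \<open>I / \<kappa>\<close>.\<close>

lemma conv_bound_of_RD_pair:
  assumes l: "length_function H l" and s: "s > 0"
    and rd: "\<And>f \<xi>. f \<in> hecke_space H \<Longrightarrow> \<xi> \<in> L2_space (coset_measure \<mu> H) \<Longrightarrow>
           L2sq (coset_measure \<mu> H) (hecke_conv \<mu> H f \<xi>)
             \<le> ennreal (c\<^sup>2) *
               (\<integral>\<^sup>+ C. ennreal ((cmod (f C))\<^sup>2 * (1 + l (rep C)) powr (2 * s)) \<partial>coset_measure \<mu> H) *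
               L2sq (coset_measure \<mu> H) \<xi>"
    and \<psi>: "Cc \<psi>" "\<And>x. \<psi> x \<ge> 0" "\<And>v h. h \<in> H \<Longrightarrow> \<psi> (v + h) = \<psi> v"
    and w: "continuous_on UNIV w" "\<And>x. (1 + l x) powr (2 * s) \<le> w x"
    and D: "D \<ge> 0" "\<And>u v z. \<psi> u \<noteq> 0 \<Longrightarrow> \<psi> v \<noteq> 0 \<Longrightarrow> w z \<le> D * w (u + z - v)"
    and f: "Cc f" "\<And>x. f x \<ge> 0" and \<xi>: "Cc \<xi>" "\<And>x. \<xi> x \<ge> 0"
  defines "\<kappa> \<equiv> (\<integral>y. \<psi> (- y) \<partial>\<mu>)" and "I \<equiv> (\<integral>y. \<psi> y \<partial>\<mu>)"
  assumes \<kappa>: "\<kappa> > 0"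
  shows "N2 (conv f \<xi>) \<le> ennreal (c\<^sup>2 * D * I / \<kappa> * (\<integral>x. (f x)\<^sup>2 * w x \<partial>\<mu>)) * N2 \<xi>"
proof -
  define P where "P = rsmear \<psi> (\<lambda>x. (f x)\<^sup>2)"
  define R where "R = smear \<psi> P"
  define Q where "Q = smear \<psi> (\<lambda>x. (\<xi> x)\<^sup>2)"
  define W where "W = (\<integral>x. (f x)\<^sup>2 * w x \<partial>\<mu>)"
  define G where "G = conv (\<lambda>x. sqrt (R x)) (\<lambda>x. sqrt (Q x))"
  have w0: "w x \<ge> 0" for x using w(2)[of x] by (rule order_trans[rotated]) simp
  have P: "Cc P" "\<And>x. P x \<ge> 0" using f \<psi> by (auto simp: P_def intro!: Cc_rsmear rsmear_nonneg Cc_power2)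
  have R: "Cc R" "\<And>x. R x \<ge> 0" using P \<psi> by (auto simp: R_def intro!: Cc_smear smear_nonneg)
  have Q: "Cc Q" "\<And>x. Q x \<ge> 0" using \<xi> \<psi> by (auto simp: Q_def intro!: Cc_smear smear_nonneg Cc_power2)
  have G: "Cc G" "\<And>x. G x \<ge> 0" unfolding G_def using R Q by (auto intro!: Cc_conv Cc_sqrt conv_nonneg)
  have g: "Cc (conv f \<xi>)" by (intro Cc_conv f \<xi>)
  have I0: "I \<ge> 0" and W0: "W \<ge> 0" using \<psi>(2) w0 by (simp_all add: I_def W_def)
  have Rl: "R (h + z) = R z" if "h \<in> H" for h z
    unfolding R_def by (intro smear_left_invariant \<psi>(1) P(1) \<psi>(3)[OF that])
  have Ql: "Q (h + z) = Q z" if "h \<in> H" for h z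
    unfolding Q_def by (intro smear_left_invariant \<psi>(1) Cc_power2 \<xi>(1) \<psi>(3)[OF that])
  have Rr: "R (z + h) = R z" if "h \<in> H" for h z
  proof -
    have "P (t + h) = P t" for t
      using rsmear_right_invariant[OF \<psi>(1) Cc_power2[OF f(1)] \<psi>(3)[OF H_minus[OF that]], of t]
      by (simp add: P_def)
    then show ?thesis unfolding R_def smear_def by (simp add: add.assoc[symmetric])
  qed
  have Rrep: "R (rep (rcoset H x)) = R x" and Qrep: "Q (rep (rcoset H x)) = Q x" for x
    using rep_rcoset[of x] Rl Ql by metis+
  define f' where "f' C = complex_of_real (sqrt (R (rep C)))" for C
  define \<xi>' where "\<xi>' C = complex_of_real (sqrt (Q (rep C)))" for C
  have f'x: "f' (rcoset H x) = complex_of_real (sqrt (R x))" and \<xi>'x: "\<xi>' (rcoset H x) = complex_of_real (sqrt (Q x))" for x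
    by (simp_all add: f'_def \<xi>'_def Rrep Qrep)
  have f': "f' \<in> hecke_space H"
  proof -
    obtain K where K: "compact K" "\<And>x. R x \<noteq> 0 \<Longrightarrow> x \<in> K" using Cc_supportE[OF R(1)] by blast
    show ?thesis
    proof (rule hecke_spaceI[OF _ _ K(1)])
      show "continuous_on UNIV (\<lambda>x. f' (rcoset H x))"
        unfolding f'x by (intro continuous_intros Cc_continuous R)
    qed (auto simp: f'x Rr K(2))
  qed
  have \<xi>'m: "\<xi>' \<in> borel_measurable (coset_borel H)"
    by (rule continuous_map_coset_borel, unfold \<xi>'x) (intro continuous_intros Cc_continuous Q)
  have \<xi>'L: "L2sq (coset_measure \<mu> H) \<xi>' = ennreal (\<kappa> * (\<integral>x. (\<xi> x)\<^sup>2 \<partial>\<mu>))"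
  proof -
    have "L2sq (coset_measure \<mu> H) \<xi>' = (\<integral>\<^sup>+x. ennreal (Q x) \<partial>\<mu>)"
      using Q(2) by (simp add: L2sq_coset[OF \<xi>'m] \<xi>'x)
    also have "\<dots> = ennreal (\<integral>x. Q x \<partial>\<mu>)"
      using Q by (intro nn_integral_eq_integral Cc_integrable) auto
    finally show ?thesis unfolding Q_def integral_smear[OF \<psi>(1) Cc_power2[OF \<xi>(1)]] by (simp add: \<kappa>_def)
  qed
  have \<xi>': "\<xi>' \<in> L2_space (coset_measure \<mu> H)"
    using \<xi>'m \<xi>'L by (simp add: L2_space_def cong: measurable_cong_sets)
  have hG: "hecke_conv \<mu> H f' \<xi>' (rcoset H x) = complex_of_real (G x)" for x
    unfolding hecke_conv_rcoset[OF f' \<xi>'m] f'x \<xi>'x of_real_mult[symmetric] integral_complex_of_real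
    by (simp add: G_def conv_def)
  have "N2 G = L2sq (coset_measure \<mu> H) (hecke_conv \<mu> H f' \<xi>')"
  proof -
    have "hecke_conv \<mu> H f' \<xi>' \<in> borel_measurable (coset_borel H)"
      by (rule continuous_map_coset_borel, unfold hG) (intro continuous_intros Cc_continuous G)
    then show ?thesis by (simp add: L2sq_coset hG N2_def)
  qed
  also have "\<dots> \<le> ennreal (c\<^sup>2) *
      (\<integral>\<^sup>+ C. ennreal ((cmod (f' C))\<^sup>2 * (1 + l (rep C)) powr (2 * s)) \<partial>coset_measure \<mu> H) *
      L2sq (coset_measure \<mu> H) \<xi>'" by (rule rd[OF f' \<xi>'])
  also have "\<dots> \<le> ennreal (c\<^sup>2) * ennreal (D * (\<kappa> * (I * W))) * ennreal (\<kappa> * (\<integral>x. (\<xi> x)\<^sup>2 \<partial>\<mu>))"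
  proof -
    \<comment> \<open>Only an upper bound is wanted, so the length function on representatives need
      not be known to be measurable on cosets.\<close>
    have "(\<integral>\<^sup>+ C. ennreal ((cmod (f' C))\<^sup>2 * (1 + l (rep C)) powr (2 * s)) \<partial>coset_measure \<mu> H)
      \<le> (\<integral>\<^sup>+ x. ennreal ((cmod (f' (rcoset H x)))\<^sup>2 * (1 + l (rep (rcoset H x))) powr (2 * s)) \<partial>\<mu>)"
      by (rule nn_integral_coset_le)
    also have "\<dots> \<le> (\<integral>\<^sup>+x. ennreal (R x * w x) \<partial>\<mu>)"
      using R(2) w(2) by (intro nn_integral_mono ennreal_leI)
        (auto simp: f'x length_rep_rcoset[OF l] intro!: mult_left_mono)
    also have "\<dots> = ennreal (\<integral>x. R x * w x \<partial>\<mu>)"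
      using R(2) w0 by (intro nn_integral_eq_integral Cc_integrable Cc_mult_left R w) auto
    also have "\<dots> \<le> ennreal (D * (\<kappa> * (I * W)))"
      unfolding R_def P_def \<kappa>_def I_def W_def
      by (intro ennreal_leI smear_weight_le \<psi> f w w0 D)
    finally show ?thesis unfolding \<xi>'L by (intro mult_right_mono mult_left_mono) auto
  qed
  also have "\<dots> = ennreal (c\<^sup>2 * (D * (\<kappa> * (I * W))) * (\<kappa> * (\<integral>x. (\<xi> x)\<^sup>2 \<partial>\<mu>)))"
    using D \<kappa> I0 W0 by (simp add: ennreal_mult)
  finally have "(\<integral>x. (G x)\<^sup>2 \<partial>\<mu>) \<le> c\<^sup>2 * (D * (\<kappa> * (I * W))) * (\<kappa> * (\<integral>x. (\<xi> x)\<^sup>2 \<partial>\<mu>))"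
    using D \<kappa> I0 W0 by (simp add: N2_Cc[OF G(1)] ennreal_le_iff)
  \<comment> \<open>Squaring the pointwise estimate gives two factors \<kappa>; integrating the
    average of the squared convolution gives the third.\<close>
  moreover have "\<kappa>\<^sup>2 * (\<kappa> * (\<integral>x. (conv f \<xi> x)\<^sup>2 \<partial>\<mu>)) \<le> (\<integral>x. (G x)\<^sup>2 \<partial>\<mu>)"
  proof -
    define B where "B = smear \<psi> (\<lambda>x. (conv f \<xi> x)\<^sup>2)"
    have B: "Cc B" "\<And>x. B x \<ge> 0" unfolding B_def using \<psi> g by (auto intro!: Cc_smear Cc_power2 smear_nonneg)
    have "\<kappa>\<^sup>2 * (\<kappa> * (\<integral>x. (conv f \<xi> x)\<^sup>2 \<partial>\<mu>)) = (\<integral>x. \<kappa>\<^sup>2 * B x \<partial>\<mu>)"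
      unfolding B_def using integral_smear[OF \<psi>(1) Cc_power2[OF g]] by (simp add: \<kappa>_def)
    also have "\<dots> \<le> (\<integral>x. (G x)\<^sup>2 \<partial>\<mu>)"
    proof (rule integral_mono)
      show "integrable \<mu> (\<lambda>x. \<kappa>\<^sup>2 * B x)" "integrable \<mu> (\<lambda>x. (G x)\<^sup>2)"
        by (intro Cc_integrable Cc_cmult Cc_power2 B G)+
      fix x
      have "\<kappa> * sqrt (B x) \<le> G x"
        unfolding B_def G_def R_def P_def Q_def \<kappa>_def by (intro smear_conv_le \<psi> f \<xi>)
      then have "(\<kappa> * sqrt (B x))\<^sup>2 \<le> (G x)\<^sup>2" using \<kappa> B(2) by (intro power_mono) auto
      then show "\<kappa>\<^sup>2 * B x \<le> (G x)\<^sup>2" using B(2) by (simp add: power_mult_distrib)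
    qed
    finally show ?thesis .
  qed
  ultimately have "\<kappa>\<^sup>2 * (\<kappa> * (\<integral>x. (conv f \<xi> x)\<^sup>2 \<partial>\<mu>)) \<le> c\<^sup>2 * (D * (\<kappa> * (I * W))) * (\<kappa> * (\<integral>x. (\<xi> x)\<^sup>2 \<partial>\<mu>))"
    by (rule order_trans[rotated])
  also have "\<dots> = \<kappa>\<^sup>2 * (c\<^sup>2 * D * I * W * (\<integral>x. (\<xi> x)\<^sup>2 \<partial>\<mu>))" by (simp add: power2_eq_square)
  finally have "\<kappa> * (\<integral>x. (conv f \<xi> x)\<^sup>2 \<partial>\<mu>) \<le> c\<^sup>2 * D * I * W * (\<integral>x. (\<xi> x)\<^sup>2 \<partial>\<mu>)"
    using \<kappa> by simp
  then have "(\<integral>x. (conv f \<xi> x)\<^sup>2 \<partial>\<mu>) \<le> c\<^sup>2 * D * I / \<kappa> * W * (\<integral>x. (\<xi> x)\<^sup>2 \<partial>\<mu>)"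
    using \<kappa> by (simp add: field_simps)
  then have "N2 (conv f \<xi>) \<le> ennreal (c\<^sup>2 * D * I / \<kappa> * W * (\<integral>x. (\<xi> x)\<^sup>2 \<partial>\<mu>))"
    unfolding N2_Cc[OF g] by (rule ennreal_leI)
  also have "\<dots> = ennreal (c\<^sup>2 * D * I / \<kappa> * W) * N2 \<xi>"
    unfolding N2_Cc[OF \<xi>(1)] using D \<kappa> I0 W0 by (intro ennreal_mult) auto
  finally show ?thesis by (simp only: W_def)
qed

text \<open>The same length function and exponent serve for the group; only the constant
  changes.\<close>

lemma RD_group_if_RD_pair:
  assumes "RD_pair \<mu> H" shows "RD_pair \<mu> {0}"
proof -
  interpret Z: haar_pair \<mu> "{0}" by (rule haar_pair_zero)
  obtain l s c where l: "length_function H l" "locally_bounded_length H l" and s: "s > 0" and c: "c > 0"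
    and rd: "\<And>f \<xi>. f \<in> hecke_space H \<Longrightarrow> \<xi> \<in> L2_space (coset_measure \<mu> H) \<Longrightarrow>
           L2sq (coset_measure \<mu> H) (hecke_conv \<mu> H f \<xi>)
             \<le> ennreal (c\<^sup>2) *
               (\<integral>\<^sup>+ C. ennreal ((cmod (f C))\<^sup>2 * (1 + l (rep C)) powr (2 * s)) \<partial>coset_measure \<mu> H) *
               L2sq (coset_measure \<mu> H) \<xi>"
    using assms unfolding RD_pair_def by blast
  have l0: "\<And>x. l x \<ge> 0" and lm: "\<And>x. l (- x) = l x" and la: "\<And>x y. l (x + y) \<le> l x + l y"
    and lb: "l \<in> borel_measurable borel" and lz: "l 0 = 0"
    using l(1) by (auto simp: length_function_def)
  note bdd = length_bounded_on_compact[OF l(2)]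
  obtain \<psi> where \<psi>: "Cc \<psi>" "\<And>x. \<psi> x \<ge> 0" "\<psi> 0 > 0" "\<And>v h. h \<in> H \<Longrightarrow> \<psi> (v + h) = \<psi> v"
    using invariant_bump[OF H] by blast
  obtain m M where m: "continuous_on UNIV m" "\<And>x. l x \<le> m x" "\<And>x. m x \<le> l x + M" "M \<ge> 0"
    using continuous_majorant[OF lb l0 lm la bdd] by blast
  have m0: "m x \<ge> 0" for x using l0[of x] m(2)[of x] by simp
  obtain B where B: "\<And>u. \<psi> u \<noteq> 0 \<Longrightarrow> l u \<le> B" "B \<ge> 0"
  proof -
    obtain K where K: "compact K" "\<And>x. \<psi> x \<noteq> 0 \<Longrightarrow> x \<in> K" using Cc_supportE[OF \<psi>(1)] by blast
    obtain B where "\<And>x. x \<in> K \<Longrightarrow> l x \<le> B" using bdd[OF K(1)] by blast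
    then show thesis using that[of "max 0 B"] K(2) by (simp add: le_max_iff_disj)
  qed
  define w where "w x = (1 + m x) powr (2 * s)" for x
  have wc: "continuous_on UNIV w"
    unfolding w_def using m0 by (intro continuous_intros m(1)) (auto simp: add_nonneg_eq_0_iff)
  have w0: "w x \<ge> 0" for x by (simp add: w_def)
  have wl: "(1 + l x) powr (2 * s) \<le> w x" for x
    unfolding w_def using m(2) l0 s by (intro powr_mono2) auto
  \<comment> \<open>On the support of \<psi> the length is at most \<open>B\<close>; undoing the
    translations by \<open>u\<close> and \<open>v\<close> costs \<open>2 * B\<close>, and returning
    from \<open>m\<close> to \<open>l\<close> costs \<open>M\<close>.\<close>
  define D where "D = (1 + 2 * B + M) powr (2 * s)"
  have wD: "w z \<le> D * w (u + z - v)" if "\<psi> u \<noteq> 0" "\<psi> v \<noteq> 0" for u v z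
    unfolding w_def D_def
  proof (rule powr_weight_mono[OF s m0 m0])
    have "z = - u + ((u + z - v) + v)" by (simp add: add.assoc[symmetric])
    then have "l z \<le> l (- u) + (l (u + z - v) + l v)"
      using la[of "- u" "(u + z - v) + v"] la[of "u + z - v" v] by simp
    then have "1 + m z \<le> 1 + m (u + z - v) + (2 * B + M)"
      using m(3)[of z] m(2)[of "u + z - v"] lm[of u] B(1)[OF that(1)] B(1)[OF that(2)] by simp
    also have "\<dots> \<le> (1 + 2 * B + M) * (1 + m (u + z - v))"
      using B(2) m(4) m0[of "u + z - v"] by (simp add: algebra_simps)
    finally show "1 + m z \<le> (1 + 2 * B + M) * (1 + m (u + z - v))" .
  qed (use B(2) m(4) in simp)
  \<comment> \<open>Price for going back from the continuous weight to the original one at the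
    end.\<close>
  define D' where "D' = (1 + M) powr (2 * s)"
  have wD': "w x \<le> D' * (1 + l x) powr (2 * s)" for x
    unfolding w_def D'_def
  proof (rule powr_weight_mono[OF s m0 l0])
    have "1 + m x \<le> 1 + l x + M" using m(3)[of x] by simp
    also have "\<dots> \<le> (1 + M) * (1 + l x)" using m(4) l0[of x] by (simp add: algebra_simps)
    finally show "1 + m x \<le> (1 + M) * (1 + l x)" .
  qed (use m(4) in simp)
  define \<kappa> where "\<kappa> = (\<integral>y. \<psi> (- y) \<partial>\<mu>)"
  define I where "I = (\<integral>y. \<psi> y \<partial>\<mu>)"
  have \<kappa>: "\<kappa> > 0"
    unfolding \<kappa>_def using Cc_translate(2)[OF \<psi>(1), of 0] \<psi>(2,3)
    by (intro Cc_integral_pos[where a=0]) auto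
  have I: "I > 0" unfolding I_def using \<psi> by (intro Cc_integral_pos[where a=0]) auto
  have D0: "D > 0" "D' > 0" using B(2) m(4) by (simp_all add: D_def D'_def add_pos_nonneg)
  \<comment> \<open>The factor 2 is the loss in extending the bound from compactly supported \<xi>
    to L2.\<close>
  define E where "E = 2 * (c\<^sup>2 * D * I / \<kappa>)"
  have E: "E > 0" using c D0 I \<kappa> by (simp add: E_def)
  have "L2sq (coset_measure \<mu> {0}) (hecke_conv \<mu> {0} f \<xi>)
     \<le> ennreal ((sqrt (E * D'))\<^sup>2) *
       (\<integral>\<^sup>+ C. ennreal ((cmod (f C))\<^sup>2 * (1 + l (rep C)) powr (2 * s)) \<partial>coset_measure \<mu> {0}) *
       L2sq (coset_measure \<mu> {0}) \<xi>"
    if f: "f \<in> hecke_space {0}" and \<xi>: "\<xi> \<in> L2_space (coset_measure \<mu> {0})" for f \<xi>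
  proof -
    define F where "F x = cmod (f {x})" for x
    define X where "X x = cmod (\<xi> {x})" for x
    have F: "Cc F" "\<And>x. F x \<ge> 0" using Z.hecke_spaceD(3)[OF f] by (simp_all add: F_def[abs_def])
    have \<xi>m: "\<xi> \<in> borel_measurable (coset_borel {0})" using \<xi> by (simp add: L2_space_def cong: measurable_cong_sets)
    have "rcoset {0} \<in> measurable borel (coset_borel {0::'g})" using Z.measurable_rcoset by (simp cong: measurable_cong_sets)
    then have "(\<lambda>x. \<xi> (rcoset {0} x)) \<in> borel_measurable borel" using \<xi>m by (rule measurable_compose)
    then have X: "X \<in> borel_measurable borel" "\<And>x. X x \<ge> 0" by (simp_all add: X_def[abs_def])
    have NX: "L2sq (coset_measure \<mu> {0}) \<xi> = N2 X" by (simp add: L2sq_coset_zero N2_def X_def)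
    then have XL: "N2 X < \<infinity>" using \<xi> by (simp add: L2_space_def)
    define W where "W = (\<integral>x. (F x)\<^sup>2 * w x \<partial>\<mu>)"
    have W0: "W \<ge> 0" using w0 by (simp add: W_def)
    have "L2sq (coset_measure \<mu> {0}) (hecke_conv \<mu> {0} f \<xi>) = (\<integral>\<^sup>+x. ennreal ((cmod (hecke_conv \<mu> {0} f \<xi> {x}))\<^sup>2) \<partial>\<mu>)"
      by (rule L2sq_coset_zero)
    \<comment> \<open>Taking absolute values under the integral reduces to nonnegative functions;
      the norms on the right depend only on absolute values.\<close>
    also have "\<dots> \<le> N2 (conv F X)"
      unfolding N2_def
    proof (intro nn_integral_mono ennreal_leI power_mono)
      fix x
      have "cmod (hecke_conv \<mu> {0} f \<xi> {x}) = cmod (\<integral>y. f {x - y} * \<xi> {y} \<partial>\<mu>)"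
        using Z.hecke_conv_rcoset[OF f \<xi>m, of x] by simp
      also have "\<dots> \<le> (\<integral>y. cmod (f {x - y} * \<xi> {y}) \<partial>\<mu>)" by (rule integral_norm_bound)
      finally show "cmod (hecke_conv \<mu> {0} f \<xi> {x}) \<le> conv F X x"
        by (simp add: conv_def F_def X_def norm_mult)
    qed simp
    also have "\<dots> \<le> ennreal (2 * (c\<^sup>2 * D * I / \<kappa> * W)) * N2 X"
    proof (rule conv_L2_bound_extend[OF F _ _ X(1) XL X(2)])
      show "0 \<le> c\<^sup>2 * D * I / \<kappa> * W" using D0 I \<kappa> W0 by simp
      show "N2 (conv F g) \<le> ennreal (c\<^sup>2 * D * I / \<kappa> * W) * N2 g" if "Cc g" "\<And>x. g x \<ge> 0" for g
        unfolding \<kappa>_def I_def W_def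
        using conv_bound_of_RD_pair[OF l(1) s rd \<psi>(1,2,4) wc wl _ wD F that] D0 \<kappa> by (simp add: \<kappa>_def)
    qed
    also have "2 * (c\<^sup>2 * D * I / \<kappa> * W) = E * W" by (simp add: E_def)
    also have "ennreal (E * W) * N2 X \<le> ennreal (E * D') * (\<integral>\<^sup>+ x. ennreal ((F x)\<^sup>2 * (1 + l x) powr (2 * s)) \<partial>\<mu>) * N2 X"
    proof (rule mult_right_mono)
      have "ennreal (E * W) = ennreal E * (\<integral>\<^sup>+x. ennreal ((F x)\<^sup>2 * w x) \<partial>\<mu>)"
      proof -
        have "(\<integral>\<^sup>+x. ennreal ((F x)\<^sup>2 * w x) \<partial>\<mu>) = ennreal W"
          unfolding W_def using w0 by (intro nn_integral_eq_integral Cc_integrable Cc_mult_left Cc_power2 F wc) auto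
        then show ?thesis using E W0 by (simp add: ennreal_mult)
      qed
      also have "\<dots> \<le> ennreal E * (\<integral>\<^sup>+x. ennreal D' * ennreal ((F x)\<^sup>2 * (1 + l x) powr (2 * s)) \<partial>\<mu>)"
      proof (intro mult_left_mono nn_integral_mono)
        fix x
        have "(F x)\<^sup>2 * w x \<le> (F x)\<^sup>2 * (D' * (1 + l x) powr (2 * s))" by (intro mult_left_mono wD') simp
        then have "ennreal ((F x)\<^sup>2 * w x) \<le> ennreal (D' * ((F x)\<^sup>2 * (1 + l x) powr (2 * s)))"
          by (intro ennreal_leI) (simp add: mult_ac)
        then show "ennreal ((F x)\<^sup>2 * w x) \<le> ennreal D' * ennreal ((F x)\<^sup>2 * (1 + l x) powr (2 * s))"
          using D0(2) by (simp add: ennreal_mult)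
      qed simp
      also have "\<dots> = ennreal E * (ennreal D' * (\<integral>\<^sup>+x. ennreal ((F x)\<^sup>2 * (1 + l x) powr (2 * s)) \<partial>\<mu>))"
        using Cc_borel[OF F(1)] lb by (subst nn_integral_cmult) auto
      finally show "ennreal (E * W) \<le> ennreal (E * D') * (\<integral>\<^sup>+ x. ennreal ((F x)\<^sup>2 * (1 + l x) powr (2 * s)) \<partial>\<mu>)"
        using E D0 by (simp add: ennreal_mult mult.assoc)
    qed simp
    finally show ?thesis using E D0 by (simp add: NX nn_integral_coset_zero F_def)
  qed
  moreover have "length_function {0} l" using l(1) lz by (auto simp: length_function_def)
  moreover have "locally_bounded_length {0} l"
    unfolding locally_bounded_length_def
  proof (intro allI impI)
    fix K assume "compactin (coset_topology {0}) (K :: 'g set set)"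
    then obtain L where L: "compact L" "\<And>x. rcoset {0} x \<in> K \<Longrightarrow> x \<in> L"
      using Z.compactin_coset_preimage by blast
    then show "\<exists>B. \<forall>x. rcoset {0} x \<in> K \<longrightarrow> l x \<le> B" using bdd[OF L(1)] by blast
  qed
  moreover have "sqrt (E * D') > 0" using E D0 by simp
  ultimately show ?thesis
    unfolding RD_pair_def using s by (intro exI[of _ l] exI[of _ s] exI[of _ "sqrt (E * D')"]) auto
qed

end

theorem theorem3p8:
  fixes \<mu> :: "'g::{topological_group_add,t2_space} measure"
    and H :: "'g set"
  assumes "locally_compact_group TYPE('g)"
    and "right_haar_measure \<mu>"
    and "compact_subgroup H"
  shows "RD_group \<mu> \<longleftrightarrow> RD_pair \<mu> H"
proof -
  interpret haar_pair \<mu> H using assms by unfold_locales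
  show ?thesis
    unfolding RD_group_def using RD_pair_if_RD_group RD_group_if_RD_pair by blast
qed

end
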